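(* Consider the $N$-player game with decentralized Markov policies described in the context. Define $\Phi:\Pi\to\mathbb{R}$ by $$\Phi(\phi):=\mathbb{E}\left[\int_0^T F\big(X^{\phi}_t,\phi(t,X^{\phi}_t)\big)\,dt+G(X^{\phi}_T)\right],\qquad \phi\in\Pi,$$ where $X^\phi=(X_i^{\phi_i})_{i\in[N]}$ is the joint state process, $\phi(t,X^\phi_t)=(\phi_i(t,X^{\phi_i}_{i,t}))_{i\in[N]}$ is the joint control process, and $F:\mathbb{R}^{dN}\times A\to\mathbb{R}$ (with $A=\prod_{i\in[N]}A_i$) and $G:\mathbb{R}^{dN}\to\mathbb{R}$ are $$F(x,a):=\sum_{i=1}^N f_i(x_i,a_i)+\sum_{1\le i<j\le N}\frac{\lambda_{ij}+\lambda_{ji}}{2}K(x_i-x_j),\qquad G(x):=\sum_{i=1}^N g_i(x_i).$$ Then $\Phi$ is an $\alpha$-potential function of the game for some $\alpha\ge 0$ with $$\alpha\le T\|K\|_{L^\infty}\max_{i\in[N]}\sum_{j\neq i}|\lambda_{ij}-\lambda_{ji}|.$$ That is, for all $i\in[N]$, $\phi_{-i}\in\Pi_{-i}$ and $\phi_i,\phi_i'\in\Pi_i$, $$\big|\big(J_i(\phi_i',\phi_{-i})-J_i(\phi_i,\phi_{-i})\big)-\big(\Phi(\phi_i',\phi_{-i})-\Phi(\phi_i,\phi_{-i})\big)\big|\le\alpha.$$ Hence any minimizer of $\Phi$ over $\Pi$ is an $\alpha$-Nash equilibrium of the game.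
   Context: Setting. $T>0$ is a fixed horizon, $[N]=\{1,\dots,N\}$ is the set of players, and $d,k,m\in\mathbb{N}$. For each $i\in[N]$, $A_i\subset\mathbb{R}^k$ is a nonempty compact action set, and $\Pi_i\subset C([0,T]\times\mathbb{R}^d;A_i)$ is a nonempty set of admissible policies, each locally Lipschitz continuous in the spatial variable (uniformly in $t\in[0,T]$). Standing assumption: each $\Pi_i$ is compact in the compact-open topology (uniform convergence on compact subsets of $[0,T]\times\mathbb{R}^d$). Let $\Pi=\prod_{i\in[N]}\Pi_i$ and $\Pi_{-i}=\prod_{j\ne i}\Pi_j$. Dynamics. $W$ is an $m$-dimensional Brownian motion on a complete probability space $(\Omega,\mathcal F,\mathbb P)$. For $\phi_i\in\Pi_i$, player $i$'s state $X_i^{\phi_i}$ solves $$dX_{i,t}=b_i(X_{i,t},\phi_i(t,X_{i,t}))\,dt+\sigma_i(X_{i,t},\phi_i(t,X_{i,t}))\,dW_t,\quad X_{i,0}=\xi_i,\quad t\in[0,T],$$ with $\xi_i\in\mathbb{R}^d$ given and $b_i:\mathbb{R}^d\times A_i\to\mathbb{R}^d$, $\sigma_i:\mathbb{R}^d\times A_i\to\mathbb{R}^{d\times m}$ Lipschitz continuous. Costs. For $\phi=(\phi_i)_{i\in[N]}\in\Pi$, player $i$ minimizes over $\phi_i\in\Pi_i$ $$J_i(\phi)=\mathbb{E}\left[\int_0^T\Big(f_i\big(X^{\phi_i}_{i,t},\phi_i(t,X^{\phi_i}_{i,t})\big)+\sum_{j\ne i}\lambda_{ij}K(X^{\phi_i}_{i,t}-X^{\phi_j}_{j,t})\Big)dt+g_i(X^{\phi_i}_{i,T})\right],$$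 where $\lambda_{ij}\ge 0$ are constants, $f_i:\mathbb{R}^d\times A_i\to\mathbb{R}$ and $g_i:\mathbb{R}^d\to\mathbb{R}$ are continuous with at most quadratic growth, and $K:\mathbb{R}^d\to\mathbb{R}$ is bounded and continuous with $K(x)=K(-x)$ for all $x$ and $K\not\equiv0$. $\|K\|_{L^\infty}$ is the sup norm. $\epsilon$-Nash equilibrium. For $\epsilon\ge0$, $\bar\phi\in\Pi$ is an $\epsilon$-Nash equilibrium if $J_i(\bar\phi)\le J_i(\phi_i,\bar\phi_{-i})+\epsilon$ for all $\phi_i\in\Pi_i$ and $i\in[N]$. *)

theory Defs
  imports "HOL-Probability.Probability"
begin

subsection \<open>The compact-open topology\<close>

text \<open>Functions on the space \<open>X\<close> are encoded extensionally (\<open>undefined\<close> outside of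
  \<open>topspace X\<close>), so that equality in HOL is equality on \<open>X\<close>.\<close>

definition cont_maps :: "'a topology \<Rightarrow> 'b topology \<Rightarrow> ('a \<Rightarrow> 'b) set" where
  "cont_maps X Y = {f. continuous_map X Y f \<and> f \<in> extensional (topspace X)}"

definition compact_open_topology :: "'a topology \<Rightarrow> 'b topology \<Rightarrow> ('a \<Rightarrow> 'b) topology" where
  "compact_open_topology X Y =
     topology_generated_by
       {{f \<in> cont_maps X Y. f ` C \<subseteq> U} | C U. compactin X C \<and> openin Y U}"

subsection \<open>Policies\<close>

definition loc_lipschitz_policy ::
  "real \<Rightarrow> (real \<times> (real^'d) \<Rightarrow> real^'k) \<Rightarrow> bool" where
  "loc_lipschitz_policy T p \<longleftrightarrow>
     (\<forall>x. \<exists>u>0. \<exists>L. \<forall>t\<in>{0..T}. L-lipschitz_on (cball x u) (\<lambda>y. p (t, y)))"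

definition policy_topology ::
  "real \<Rightarrow> (real^'k) set \<Rightarrow> (real \<times> (real^'d) \<Rightarrow> real^'k) topology" where
  "policy_topology T A =
     compact_open_topology (top_of_set ({0..T} \<times> UNIV)) (top_of_set A)"

definition admissible_policies ::
  "real \<Rightarrow> (real^'k) set \<Rightarrow> (real \<times> (real^'d) \<Rightarrow> real^'k) set \<Rightarrow> bool" where
  "admissible_policies T A P \<longleftrightarrow>
     P \<noteq> {} \<and> P \<subseteq> cont_maps (top_of_set ({0..T} \<times> UNIV)) (top_of_set A) \<and>
     (\<forall>p\<in>P. loc_lipschitz_policy T p) \<and>
     compactin (policy_topology T A) P"

subsection \<open>Brownian motion\<close>

definition past_events :: "'w measure \<Rightarrow> (real \<Rightarrow> 'w \<Rightarrow> real^'m) \<Rightarrow> real \<Rightarrow> 'w set set" where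
  "past_events M W t = {W s -` B \<inter> space M | s B. 0 \<le> s \<and> s \<le> t \<and> B \<in> sets borel}"

definition brownian_motion :: "'w measure \<Rightarrow> (real \<Rightarrow> 'w \<Rightarrow> real^'m) \<Rightarrow> bool" where
  "brownian_motion M W \<longleftrightarrow>
     (\<forall>t\<ge>0. W t \<in> borel_measurable M) \<and>
     (AE \<omega> in M. W 0 \<omega> = 0) \<and>
     (AE \<omega> in M. continuous_on {0..} (\<lambda>t. W t \<omega>)) \<and>
     (\<forall>s t. 0 \<le> s \<and> s < t \<longrightarrow>
        prob_space.indep_set M (sigma_sets (space M) (past_events M W s))
          {(\<lambda>\<omega>. W t \<omega> - W s \<omega>) -` B \<inter> space M | B. B \<in> sets borel} \<and>
        prob_space.indep_vars M (\<lambda>_. borel) (\<lambda>j \<omega>. (W t \<omega> - W s \<omega>) $ j) UNIV \<and>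
        (\<forall>j. distributed M lborel (\<lambda>\<omega>. (W t \<omega> - W s \<omega>) $ j)
               (normal_density 0 (sqrt (t - s)))))"

text \<open>The filtration generated by \<open>W\<close>, augmented by the null sets.\<close>

definition brownian_filtration ::
  "'w measure \<Rightarrow> (real \<Rightarrow> 'w \<Rightarrow> real^'m) \<Rightarrow> real \<Rightarrow> 'w measure" where
  "brownian_filtration M W t = sigma (space M) (past_events M W t \<union> null_sets M)"

definition progressively_measurable ::
  "(real \<Rightarrow> 'w measure) \<Rightarrow> real \<Rightarrow> (real \<Rightarrow> 'w \<Rightarrow> 'b::topological_space) \<Rightarrow> bool" where
  "progressively_measurable F T H \<longleftrightarrow>
     (\<forall>t\<in>{0..T}. (\<lambda>(s, \<omega>). H s \<omega>) \<in>
        borel_measurable (restrict_space borel {0..t} \<Otimes>\<^sub>M F t))"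

subsection \<open>The Ito integral\<close>

text \<open>A simple integrand on \<open>[0,T]\<close> is given by a partition \<open>p 0 < \<dots> < p n\<close> and bounded,
  \<open>F (p k)\<close>-measurable values \<open>\<eta> k\<close>, attained on the interval \<open>(p k, p (k + 1)]\<close>.\<close>

definition simple_integrand ::
  "'w measure \<Rightarrow> (real \<Rightarrow> 'w measure) \<Rightarrow> real \<Rightarrow>
   nat \<Rightarrow> (nat \<Rightarrow> real) \<Rightarrow> (nat \<Rightarrow> 'w \<Rightarrow> real^'m^'d) \<Rightarrow> bool" where
  "simple_integrand M F T n p \<eta> \<longleftrightarrow>
     p 0 = 0 \<and> p n = T \<and> (\<forall>k<n. p k < p (Suc k)) \<and>
     (\<forall>k<n. \<eta> k \<in> borel_measurable (F (p k)) \<and> bounded (\<eta> k ` space M))"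

definition simple_process ::
  "nat \<Rightarrow> (nat \<Rightarrow> real) \<Rightarrow> (nat \<Rightarrow> 'w \<Rightarrow> real^'m^'d) \<Rightarrow> real \<Rightarrow> 'w \<Rightarrow> real^'m^'d" where
  "simple_process n p \<eta> t \<omega> = (\<Sum>k<n. indicat_real {p k<..p (Suc k)} t *\<^sub>R \<eta> k \<omega>)"

definition simple_integral ::
  "(real \<Rightarrow> 'w \<Rightarrow> real^'m) \<Rightarrow> nat \<Rightarrow> (nat \<Rightarrow> real) \<Rightarrow> (nat \<Rightarrow> 'w \<Rightarrow> real^'m^'d) \<Rightarrow>
   real \<Rightarrow> 'w \<Rightarrow> real^'d" where
  "simple_integral W n p \<eta> t \<omega> =
     (\<Sum>k<n. \<eta> k \<omega> *v (W (min (p (Suc k)) t) \<omega> - W (min (p k) t) \<omega>))"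

text \<open>\<open>I t\<close> is a version of the integral of \<open>H\<close> over \<open>[0,t]\<close> with respect to \<open>W\<close>,
  for each \<open>t \<in> [0,T]\<close>: for progressively measurable \<open>H\<close> with almost surely square integrable
  paths, it is the limit in probability of the integrals of simple processes converging to
  \<open>H\<close> in \<open>L\<^sup>2([0,T])\<close>, in probability. The matrix norm is the Frobenius norm.\<close>

definition has_ito_integral ::
  "'w measure \<Rightarrow> (real \<Rightarrow> 'w measure) \<Rightarrow> (real \<Rightarrow> 'w \<Rightarrow> real^'m) \<Rightarrow> real \<Rightarrow>
   (real \<Rightarrow> 'w \<Rightarrow> real^'m^'d) \<Rightarrow> (real \<Rightarrow> 'w \<Rightarrow> real^'d) \<Rightarrow> bool" where
  "has_ito_integral M F W T H I \<longleftrightarrow>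
     progressively_measurable F T H \<and>
     (AE \<omega> in M. (\<integral>\<^sup>+t\<in>{0..T}. ennreal ((norm (H t \<omega>))\<^sup>2) \<partial>lborel) < \<infinity>) \<and>
     (\<forall>t\<in>{0..T}. I t \<in> borel_measurable M) \<and>
     (\<exists>n p \<eta>.
        (\<forall>l. simple_integrand M F T (n l) (p l) (\<eta> l)) \<and>
        (\<forall>\<epsilon>>0. (\<lambda>l. measure M {\<omega> \<in> space M.
            ennreal \<epsilon> <
              (\<integral>\<^sup>+t\<in>{0..T}. ennreal ((norm (simple_process (n l) (p l) (\<eta> l) t \<omega> - H t \<omega>))\<^sup>2)
                 \<partial>lborel)}) \<longlonglongrightarrow> 0) \<and>
        (\<forall>t\<in>{0..T}. \<forall>\<epsilon>>0. (\<lambda>l. measure M {\<omega> \<in> space M.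
            \<epsilon> < norm (simple_integral W (n l) (p l) (\<eta> l) t \<omega> - I t \<omega>)}) \<longlonglongrightarrow> 0))"

subsection \<open>Strong solutions of stochastic differential equations\<close>

definition sde_solution ::
  "'w measure \<Rightarrow> (real \<Rightarrow> 'w \<Rightarrow> real^'m) \<Rightarrow> real \<Rightarrow>
   (real \<Rightarrow> real^'d \<Rightarrow> real^'d) \<Rightarrow> (real \<Rightarrow> real^'d \<Rightarrow> real^'m^'d) \<Rightarrow> real^'d \<Rightarrow>
   (real \<Rightarrow> 'w \<Rightarrow> real^'d) \<Rightarrow> bool" where
  "sde_solution M W T \<mu> \<sigma> \<xi> X \<longleftrightarrow>
     (\<forall>t\<in>{0..T}. X t \<in> borel_measurable (brownian_filtration M W t)) \<and>
     (\<forall>\<omega>\<in>space M. continuous_on {0..T} (\<lambda>t. X t \<omega>)) \<and>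
     (AE \<omega> in M. set_integrable lborel {0..T} (\<lambda>t. \<mu> t (X t \<omega>))) \<and>
     (\<exists>I. has_ito_integral M (brownian_filtration M W) W T (\<lambda>t \<omega>. \<sigma> t (X t \<omega>)) I \<and>
        (\<forall>t\<in>{0..T}. AE \<omega> in M.
           X t \<omega> = \<xi> + (LINT s:{0..t}|lborel. \<mu> s (X s \<omega>)) + I t \<omega>))"

subsection \<open>The game\<close>

text \<open>The players are \<open>1, \<dots>, N\<close>. A policy profile is an extensional function on \<open>{1..N}\<close>, and
  \<open>X i p\<close> is the state process of player \<open>i\<close> using the policy \<open>p\<close>.\<close>

definition player_cost ::
  "'w measure \<Rightarrow> real \<Rightarrow> nat \<Rightarrow> (nat \<Rightarrow> real^'d \<Rightarrow> real^'k \<Rightarrow> real) \<Rightarrow> (nat \<Rightarrow> real^'d \<Rightarrow> real) \<Rightarrow>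
   (nat \<Rightarrow> nat \<Rightarrow> real) \<Rightarrow> (real^'d \<Rightarrow> real) \<Rightarrow>
   (nat \<Rightarrow> (real \<times> (real^'d) \<Rightarrow> real^'k) \<Rightarrow> real \<Rightarrow> 'w \<Rightarrow> real^'d) \<Rightarrow>
   nat \<Rightarrow> (nat \<Rightarrow> real \<times> (real^'d) \<Rightarrow> real^'k) \<Rightarrow> real" where
  "player_cost M T N f g lam K X i \<phi> =
     (LINT \<omega>|M.
        (LINT t:{0..T}|lborel.
           f i (X i (\<phi> i) t \<omega>) (\<phi> i (t, X i (\<phi> i) t \<omega>)) +
           (\<Sum>j\<in>{1..N} - {i}. lam i j * K (X i (\<phi> i) t \<omega> - X j (\<phi> j) t \<omega>))) +
        g i (X i (\<phi> i) T \<omega>))"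

definition potential_running ::
  "nat \<Rightarrow> (nat \<Rightarrow> real^'d \<Rightarrow> real^'k \<Rightarrow> real) \<Rightarrow> (nat \<Rightarrow> nat \<Rightarrow> real) \<Rightarrow> (real^'d \<Rightarrow> real) \<Rightarrow>
   (nat \<Rightarrow> real^'d) \<Rightarrow> (nat \<Rightarrow> real^'k) \<Rightarrow> real" where
  "potential_running N f lam K x a =
     (\<Sum>i\<in>{1..N}. f i (x i) (a i)) +
     (\<Sum>i\<in>{1..N}. \<Sum>j\<in>{i<..N}. (lam i j + lam j i) / 2 * K (x i - x j))"

definition potential_terminal ::
  "nat \<Rightarrow> (nat \<Rightarrow> real^'d \<Rightarrow> real) \<Rightarrow> (nat \<Rightarrow> real^'d) \<Rightarrow> real" where
  "potential_terminal N g x = (\<Sum>i\<in>{1..N}. g i (x i))"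

definition potential ::
  "'w measure \<Rightarrow> real \<Rightarrow> nat \<Rightarrow> (nat \<Rightarrow> real^'d \<Rightarrow> real^'k \<Rightarrow> real) \<Rightarrow> (nat \<Rightarrow> real^'d \<Rightarrow> real) \<Rightarrow>
   (nat \<Rightarrow> nat \<Rightarrow> real) \<Rightarrow> (real^'d \<Rightarrow> real) \<Rightarrow>
   (nat \<Rightarrow> (real \<times> (real^'d) \<Rightarrow> real^'k) \<Rightarrow> real \<Rightarrow> 'w \<Rightarrow> real^'d) \<Rightarrow>
   (nat \<Rightarrow> real \<times> (real^'d) \<Rightarrow> real^'k) \<Rightarrow> real" where
  "potential M T N f g lam K X \<phi> =
     (LINT \<omega>|M.
        (LINT t:{0..T}|lborel.
           potential_running N f lam K
             (\<lambda>i. X i (\<phi> i) t \<omega>) (\<lambda>i. \<phi> i (t, X i (\<phi> i) t \<omega>))) +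
        potential_terminal N g (\<lambda>i. X i (\<phi> i) T \<omega>))"

definition alpha_potential_function ::
  "nat \<Rightarrow> (nat \<Rightarrow> 'p set) \<Rightarrow> (nat \<Rightarrow> (nat \<Rightarrow> 'p) \<Rightarrow> real) \<Rightarrow> real \<Rightarrow>
   ((nat \<Rightarrow> 'p) \<Rightarrow> real) \<Rightarrow> bool" where
  "alpha_potential_function N P J \<alpha> \<Phi> \<longleftrightarrow>
     (\<forall>i\<in>{1..N}. \<forall>\<phi>\<in>PiE ({1..N} - {i}) P. \<forall>p\<in>P i. \<forall>p'\<in>P i.
        \<bar>(J i (\<phi>(i := p')) - J i (\<phi>(i := p))) - (\<Phi> (\<phi>(i := p')) - \<Phi> (\<phi>(i := p)))\<bar> \<le> \<alpha>)"

definition nash_equilibrium ::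
  "nat \<Rightarrow> (nat \<Rightarrow> 'p set) \<Rightarrow> (nat \<Rightarrow> (nat \<Rightarrow> 'p) \<Rightarrow> real) \<Rightarrow> real \<Rightarrow> (nat \<Rightarrow> 'p) \<Rightarrow> bool" where
  "nash_equilibrium N P J \<epsilon> \<phi> \<longleftrightarrow>
     \<phi> \<in> PiE {1..N} P \<and> (\<forall>i\<in>{1..N}. \<forall>p\<in>P i. J i \<phi> \<le> J i (\<phi>(i := p)) + \<epsilon>)"

end

(* When player i deviates, only the interaction terms of pairs containing i change. Player i weights
   such a pair by lam i j and the potential by the mean of lam i j and lam j i, so for
   even K the two cost differences differ by at most half of |lam i j - lam j i| times the change of
   the expected interaction, which is bounded by twice T * sup |K|.

   The cancellation requires all costs to be integrable, hence E |X t|^2 to be bounded. As the Ito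
   integral is given as a limit in probability, its second moment is controlled after truncation.
   Stopping an approximating simple integrand before its quadratic variation exceeds Q, the Ito
   isometry and Fatou's lemma give E [|I t|^2; 2 V t < Q] <= 2 E min (V t) Q, where V is the
   quadratic variation of I. With linear growth of the coefficients, this becomes a Gronwall
   inequality for E min (U t) Q, where U is the time integral of a multiple of (1 + |X|)^2, whose
   bound does not depend on Q. *)

theory Submission
  imports Defs
begin

text \<open>The Ito integral is characterised one time at a time, as a limit in probability; no
  martingale property and no path continuity of \<open>I\<close> is at hand, so \<open>X\<close> is
  not stopped at exit times. Stopping happens inside the simple integrands, where it is a finite
  operation, and only the truncation at level \<open>Q\<close> survives the limit. The variations of
  the approximants are merely bounded by twice that of the limit plus a vanishing error; this
  explains the factors 2, which Gronwall absorbs.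

  \<open>U\<close> dominates twice the quadratic variation and, up to the factor \<open>T\<close>,
  the squared norm of the integrated drift. It is also strictly increasing, hence its own clock:
  until \<open>U\<close> reaches \<open>Q\<close>, the event \<open>U s < Q\<close> holds at every
  earlier time. So \<open>min (U t) Q\<close> is at most the time integral of the rate of
  \<open>U\<close> over those \<open>s\<close> with \<open>U s < Q\<close>; Tonelli moves the
  expectation inside, and the moment bound at the single time \<open>s\<close> closes the
  inequality. Truncation also supplies the finiteness that Gronwall requires beforehand: the
  truncated expectation is at most \<open>Q\<close>, while that of \<open>U t\<close> is not yet
  known to be finite.\<close>

subsection \<open>Independence of Brownian increments from the augmented filtration\<close>

text \<open>Agreement with a member of the raw sigma-algebra up to a null set is preserved by
  complements and countable unions. This carries independence, which is assumed only for the past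
  generated by \<open>W\<close>, over to the filtration augmented by null sets.\<close>

lemma sigma_sets_Un_null_sets_approx:
  assumes S: "S \<subseteq> sets M" and A: "A \<in> sigma_sets (space M) (S \<union> null_sets M)"
  shows "\<exists>B\<in>sigma_sets (space M) S. \<exists>Z\<in>null_sets M. (A - B) \<union> (B - A) \<subseteq> Z"
  using A
proof induction
  case (Basic a)
  then show ?case
  proof
    assume "a \<in> S"
    then show ?thesis by (intro bexI[of _ a] bexI[of _ "{}"]) auto
  next
    assume "a \<in> null_sets M"
    then show ?thesis by (intro bexI[of _ "{}"] bexI[of _ a]) (auto intro: sigma_sets.Empty)
  qed
next
  case Empty
  show ?case by (intro bexI[of _ "{}"]) (auto intro: sigma_sets.Empty)
next
  case (Compl a)
  then obtain B Z where "B \<in> sigma_sets (space M) S" "Z \<in> null_sets M" "(a - B) \<union> (B - a) \<subseteq> Z"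
    by auto
  then show ?case
    by (intro bexI[of _ "space M - B"] bexI[of _ Z]) (auto intro: sigma_sets.Compl)
next
  case (Union a)
  then obtain B Z where "\<And>i. B i \<in> sigma_sets (space M) S" "\<And>i. Z i \<in> null_sets M"
     "\<And>i. (a i - B i) \<union> (B i - a i) \<subseteq> Z i"
    by metis
  then show ?case
    by (intro bexI[of _ "\<Union>i. B i"] bexI[of _ "\<Union>i::nat. Z i"])
       (auto intro: sigma_sets.Union null_sets_UN, blast+)
qed

locale brownian = prob_space M for M :: "'w measure" +
  fixes W :: "real \<Rightarrow> 'w \<Rightarrow> real^'m"
  assumes brownian: "brownian_motion M W"
begin

abbreviation \<F> :: "real \<Rightarrow> 'w measure" where
  "\<F> \<equiv> brownian_filtration M W"

lemma W_measurable: "0 \<le> t \<Longrightarrow> W t \<in> borel_measurable M"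
  using brownian by (auto simp: brownian_motion_def)

lemma past_events_subset: "past_events M W t \<subseteq> sets M"
  using W_measurable by (auto simp: past_events_def intro!: measurable_sets)

lemma space_filtration [simp]: "space (\<F> t) = space M"
  using past_events_subset[of t] sets.sets_into_space null_sets.sets_into_space
  unfolding brownian_filtration_def by (subst space_measure_of) blast+

lemma sets_filtration: "sets (\<F> t) = sigma_sets (space M) (past_events M W t \<union> null_sets M)"
  using past_events_subset[of t] sets.sets_into_space null_sets.sets_into_space
  unfolding brownian_filtration_def by (subst sets_measure_of) blast+

lemma sets_filtration_subset: "sets (\<F> t) \<subseteq> sets M"
  unfolding sets_filtration using past_events_subset[of t]
  by (intro sets.sigma_sets_subset) auto

lemma sets_filtration_mono: "s \<le> t \<Longrightarrow> sets (\<F> s) \<subseteq> sets (\<F> t)"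
  unfolding sets_filtration past_events_def
  by (intro sigma_sets_mono') (fastforce intro: order_trans)

lemma measurable_filtration_mono:
  "f \<in> measurable (\<F> s) N \<Longrightarrow> s \<le> t \<Longrightarrow> f \<in> measurable (\<F> t) N"
  using measurable_mono[of N N "\<F> s" "\<F> t"] sets_filtration_mono[of s t] by auto

lemma measurable_filtration_imp: "f \<in> measurable (\<F> s) N \<Longrightarrow> f \<in> measurable M N"
  using measurable_mono[of N N "\<F> s" M] sets_filtration_subset[of s] by auto

lemma W_filtration: "0 \<le> s \<Longrightarrow> s \<le> t \<Longrightarrow> W s \<in> borel_measurable (\<F> t)"
  by (rule measurableI) (auto simp: sets_filtration past_events_def intro!: sigma_sets.Basic)

lemma W_increment_measurable:
  "0 \<le> s \<Longrightarrow> s \<le> t \<Longrightarrow> (\<lambda>\<omega>. W t \<omega> - W s \<omega>) \<in> borel_measurable M"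
  using W_measurable[of t] W_measurable[of s] by auto

text \<open>Probabilities do not see null sets, so each event of \<open>\<F> s\<close> may be
  replaced by one of the raw past. The function \<open>h\<close> lets one statement cover both
  single components of the increment and products of two components.\<close>

lemma indep_filtration_increment:
  fixes Y :: "'w \<Rightarrow> real" and h :: "real^'m \<Rightarrow> real"
  assumes st: "0 \<le> s" "s < t" and Y: "Y \<in> borel_measurable (\<F> s)"
    and h: "h \<in> borel_measurable borel"
  shows "indep_var borel Y borel (\<lambda>\<omega>. h (W t \<omega> - W s \<omega>))"
proof -
  let ?D = "\<lambda>\<omega>. W t \<omega> - W s \<omega>"
  note D_meas[measurable] = W_increment_measurable[of s t]
  have ind: "indep_set (sigma_sets (space M) (past_events M W s))
          {?D -` B \<inter> space M | B. B \<in> sets borel}"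
    using brownian st by (auto simp: brownian_motion_def)
  have "indep_set (sets (\<F> s)) {?D -` B \<inter> space M | B. B \<in> sets borel}"
  proof (rule indep_setI)
    show "sets (\<F> s) \<subseteq> events" by (rule sets_filtration_subset)
    show ev2: "{?D -` B \<inter> space M | B. B \<in> sets borel} \<subseteq> events"
      using ind by (rule indep_setD_ev2)
    fix A D assume A: "A \<in> sets (\<F> s)" and D: "D \<in> {?D -` B \<inter> space M | B. B \<in> sets borel}"
    obtain B Z where B: "B \<in> sigma_sets (space M) (past_events M W s)" and Z: "Z \<in> null_sets M"
      and AB: "(A - B) \<union> (B - A) \<subseteq> Z"
      using sigma_sets_Un_null_sets_approx[OF past_events_subset] A unfolding sets_filtration by blast
    have [measurable]: "B \<in> events" "A \<in> events" "D \<in> events"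
      using indep_setD_ev1[OF ind] ev2 B A D sets_filtration_subset by auto
    have ae: "AE \<omega> in M. \<omega> \<in> A \<longleftrightarrow> \<omega> \<in> B"
      using AE_not_in[OF Z] AB by (auto elim!: eventually_mono)
    have "prob (A \<inter> D) = prob (B \<inter> D)" "prob A = prob B"
      using ae by (auto intro!: finite_measure_eq_AE)
    then show "prob (A \<inter> D) = prob A * prob D"
      using indep_setD[OF ind B D] by simp
  qed
  \<comment> \<open>Independence of random variables is expressed through generated sigma-algebras,
    so both families are closed up; this requires them to be stable under intersections.\<close>
  then have i2: "indep_set (sigma_sets (space M) (sets (\<F> s)))
     (sigma_sets (space M) {?D -` B \<inter> space M | B. B \<in> sets borel})"
  proof (rule indep_set_sigma_sets)
    have "?D -` B \<inter> space M \<inter> (?D -` C \<inter> space M) = ?D -` (B \<inter> C) \<inter> space M" for B C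
      by auto
    then show "Int_stable {?D -` B \<inter> space M | B. B \<in> sets borel}"
      unfolding Int_stable_def by (smt (verit) mem_Collect_eq sets.Int)
  qed (rule sets.Int_stable)
  show ?thesis
    unfolding indep_var_eq
  proof (intro conjI)
    show "random_variable borel Y" using Y by (rule measurable_filtration_imp)
    show "random_variable borel (\<lambda>\<omega>. h (?D \<omega>))" using h st by simp
    show "indep_set (sigma_sets (space M) {Y -` A \<inter> space M |A. A \<in> sets borel})
      (sigma_sets (space M) {(\<lambda>\<omega>. h (?D \<omega>)) -` A \<inter> space M |A. A \<in> sets borel})"
      using i2 unfolding indep_set_def
    proof (rule indep_sets_mono_sets)
      fix i :: bool
      have "{Y -` A \<inter> space M |A. A \<in> sets borel} \<subseteq> sets (\<F> s)"
        using measurable_sets[OF Y] by auto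
      moreover have "{(\<lambda>\<omega>. h (?D \<omega>)) -` A \<inter> space M |A. A \<in> sets borel} \<subseteq>
         {?D -` B \<inter> space M | B. B \<in> sets borel}"
      proof clarify
        fix A :: "real set" assume "A \<in> sets borel"
        then have "h -` A \<in> sets borel" using measurable_sets[OF h, of A] by simp
        then show "\<exists>B. (\<lambda>\<omega>. h (?D \<omega>)) -` A \<inter> space M = ?D -` B \<inter> space M \<and> B \<in> sets borel"
          by (intro exI[of _ "h -` A"]) auto
      qed
      ultimately show "case_bool
          (sigma_sets (space M) {Y -` A \<inter> space M |A. A \<in> sets borel})
          (sigma_sets (space M) {(\<lambda>\<omega>. h (?D \<omega>)) -` A \<inter> space M |A. A \<in> sets borel}) i
        \<subseteq> case_bool (sigma_sets (space M) (sets (\<F> s)))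
           (sigma_sets (space M) {?D -` B \<inter> space M | B. B \<in> sets borel}) i"
        by (cases i) (simp_all only: bool.case sigma_sets_mono')
    qed
  qed
qed

text \<open>Distinct components are independent and centred, so the covariance is
  \<open>t - s\<close> times the identity; this is what produces the Frobenius norm in the isometry.
  Strictness of \<open>s < t\<close> keeps the normal density nondegenerate.\<close>

lemma increment_moments:
  assumes st: "0 \<le> s" "s < t"
  shows "integrable M (\<lambda>\<omega>. (W t \<omega> - W s \<omega>) $ j)"
    and "expectation (\<lambda>\<omega>. (W t \<omega> - W s \<omega>) $ j) = 0"
    and "integrable M (\<lambda>\<omega>. (W t \<omega> - W s \<omega>) $ i * (W t \<omega> - W s \<omega>) $ j)"
    and "expectation (\<lambda>\<omega>. (W t \<omega> - W s \<omega>) $ i * (W t \<omega> - W s \<omega>) $ j) = (if i = j then t - s else 0)"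
proof -
  let ?D = "\<lambda>j \<omega>. (W t \<omega> - W s \<omega>) $ j"
  have pos: "0 < sqrt (t - s)" using st by simp
  have D: "distributed M lborel (?D j) (normal_density 0 (sqrt (t - s)))" for j
    using brownian st by (auto simp: brownian_motion_def)
  have int1: "integrable M (?D j)" for j
    using integrable_normal_moment_nz_1[OF pos, of 0] distributed_integrable[OF D, of "\<lambda>x. x"]
    by simp
  have e1: "expectation (?D j) = 0" for j
    by (rule normal_distributed_expectation[OF pos D])
  have int2: "integrable M (\<lambda>\<omega>. ?D j \<omega> * ?D j \<omega>)" for j
    using integrable_normal_moment[OF pos, of 0 2] distributed_integrable[OF D, of "\<lambda>x. x * x"]
    by (simp add: power2_eq_square)
  have e2: "expectation (\<lambda>\<omega>. ?D j \<omega> * ?D j \<omega>) = t - s" for j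
    using normal_distributed_variance[OF pos D, of j] st unfolding e1 by (simp add: power2_eq_square)
  have iv: "indep_vars (\<lambda>_. borel) ?D UNIV"
    using brownian st by (auto simp: brownian_motion_def)
  have ij: "indep_var borel (?D i) borel (?D j)" if "i \<noteq> j" for i j
    using indep_var_compose[OF indep_var_restrict[OF iv, of "{i}" "{j}"],
      of "\<lambda>f. f i" borel "\<lambda>f. f j" borel] that
    by (simp add: comp_def measurable_component_singleton)
  show "integrable M (?D j)" "expectation (?D j) = 0" by (fact int1 e1)+
  show "integrable M (\<lambda>\<omega>. ?D i \<omega> * ?D j \<omega>)"
    using int2[of j] indep_var_integrable[OF ij int1 int1] by (cases "i = j") auto
  show "expectation (\<lambda>\<omega>. ?D i \<omega> * ?D j \<omega>) = (if i = j then t - s else 0)"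
    using e2[of j] indep_var_lebesgue_integral[OF ij int1 int1] e1 by (cases "i = j") auto
qed

end

subsection \<open>Truncated second moments of Ito integrals\<close>

lemma borel_measurable_vec_nth:
  fixes f :: "'a \<Rightarrow> ('b::{metric_space, second_countable_topology})^'n"
  shows "f \<in> borel_measurable N \<Longrightarrow> (\<lambda>x. f x $ i) \<in> borel_measurable N"
  by (rule measurable_compose[of f N borel])
     (auto intro!: borel_measurable_continuous_onI continuous_intros)

lemma borel_measurable_matrix_vector_mult:
  fixes A :: "'a \<Rightarrow> real^'m^'n" and x :: "'a \<Rightarrow> real^'m"
  assumes "A \<in> borel_measurable N" "x \<in> borel_measurable N"
  shows "(\<lambda>\<omega>. A \<omega> *v x \<omega>) \<in> borel_measurable N"
proof -
  have "continuous_on UNIV (\<lambda>(A :: real^'m^'n, x). A *v x)"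
    by (auto simp: matrix_vector_mult_def case_prod_unfold intro!: continuous_intros)
  from borel_measurable_continuous_onI[OF this] show ?thesis
    using measurable_compose[OF borel_measurable_Pair[OF assms], of "\<lambda>(A, x). A *v x" borel]
    by simp
qed

lemma power2_norm_vec: "(norm (x :: real^'n))\<^sup>2 = (\<Sum>i\<in>UNIV. (x $ i)\<^sup>2)"
  by (simp add: norm_vec_def L2_set_def sum_nonneg)

lemma power2_norm_matrix: "(norm (A :: real^'m^'n))\<^sup>2 = (\<Sum>i\<in>UNIV. \<Sum>j\<in>UNIV. (A $ i $ j)\<^sup>2)"
  by (simp add: norm_vec_def L2_set_def sum_nonneg)

text \<open>Induction on \<open>n\<close>. If the last term is kept, the full sum is at most
  \<open>Q\<close> and dominates the kept part; if it is dropped, the previous bound persists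
  because the full sum only grows.\<close>

lemma sum_truncated_le_min:
  fixes a :: "nat \<Rightarrow> real"
  assumes "\<And>k. k < n \<Longrightarrow> 0 \<le> a k" "0 \<le> Q"
  shows "(\<Sum>k<n. if (\<Sum>j\<le>k. a j) \<le> Q then a k else 0) \<le> min (\<Sum>k<n. a k) Q"
  using assms(1)
proof (induction n)
  case (Suc n)
  then have "(\<Sum>k<n. if (\<Sum>j\<le>k. a j) \<le> Q then a k else 0) \<le> min (\<Sum>k<n. a k) Q" "0 \<le> a n"
    by auto
  then show ?case
    by (auto simp: lessThan_Suc_atMost[symmetric])
qed (use assms in auto)

context brownian
begin

text \<open>One step of the Ito isometry. Mixed terms vanish because the increment is centred and
  independent of \<open>\<F> s\<close>; the quadratic term collapses to its diagonal. Square
  integrability of \<open>Y\<close> and boundedness of \<open>Z\<close> make every product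
  integrable.\<close>

lemma integrable_add_matrix_increment:
  fixes Y :: "'w \<Rightarrow> real^'d" and Z :: "'w \<Rightarrow> real^'m^'d"
  assumes st: "0 \<le> s" "s < t"
    and Y: "Y \<in> borel_measurable (\<F> s)" "integrable M (\<lambda>\<omega>. (norm (Y \<omega>))\<^sup>2)"
    and Z: "Z \<in> borel_measurable (\<F> s)" "bounded (Z ` space M)"
  defines "R \<equiv> \<lambda>\<omega>. Y \<omega> + Z \<omega> *v (W t \<omega> - W s \<omega>)"
  shows "integrable M (\<lambda>\<omega>. (norm (R \<omega>))\<^sup>2)"
    and "expectation (\<lambda>\<omega>. (norm (R \<omega>))\<^sup>2) =
      expectation (\<lambda>\<omega>. (norm (Y \<omega>))\<^sup>2) + expectation (\<lambda>\<omega>. (norm (Z \<omega>))\<^sup>2) * (t - s)"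
proof -
  define D where "D \<omega> = W t \<omega> - W s \<omega>" for \<omega>
  note mom = increment_moments[OF st, folded D_def]
  obtain B where B: "\<And>\<omega>. \<omega> \<in> space M \<Longrightarrow> norm (Z \<omega>) \<le> B"
    using Z(2) by (auto simp: bounded_iff)
  have Bij: "\<bar>Z \<omega> $ i $ j\<bar> \<le> B" if "\<omega> \<in> space M" for \<omega> i j
  proof -
    have "\<bar>Z \<omega> $ i $ j\<bar> \<le> norm (Z \<omega> $ i)" by (rule component_le_norm_cart)
    also have "\<dots> \<le> norm (Z \<omega>)" by (rule Finite_Cartesian_Product.norm_nth_le)
    finally show ?thesis using B[OF that] by simp
  qed
  have Zm: "(\<lambda>\<omega>. Z \<omega> $ i $ j) \<in> borel_measurable (\<F> s)" for i j
    by (intro borel_measurable_vec_nth Z)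
  have Ym: "(\<lambda>\<omega>. Y \<omega> $ i) \<in> borel_measurable (\<F> s)" for i
    by (intro borel_measurable_vec_nth Y)
  note [measurable] = measurable_filtration_imp[OF Zm] measurable_filtration_imp[OF Ym]
    measurable_filtration_imp[OF Z(1)] measurable_filtration_imp[OF Y(1)]
  have intY: "integrable M (\<lambda>\<omega>. Y \<omega> $ i)" for i
  proof (rule square_integrable_imp_integrable)
    show "integrable M (\<lambda>\<omega>. (Y \<omega> $ i)\<^sup>2)"
      by (rule Bochner_Integration.integrable_bound[OF Y(2)])
        (auto intro!: AE_I2 simp: abs_le_square_iff[symmetric] component_le_norm_cart)
  qed simp
  have intYZ: "integrable M (\<lambda>\<omega>. Y \<omega> $ i * Z \<omega> $ i $ j)" for i j
    by (rule Bochner_Integration.integrable_bound[OF integrable_mult_right[OF integrable_abs[OF intY[of i]], of B]])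
      (auto intro!: AE_I2 mult_mono Bij simp: abs_mult mult.commute[of B] intro: order_trans[OF _ abs_ge_self])
  have intZZ: "integrable M (\<lambda>\<omega>. Z \<omega> $ i $ j * Z \<omega> $ i $ k)" for i j k
    by (rule integrable_const_bound[of _ "B * B"])
      (auto intro!: AE_I2 mult_mono Bij simp: abs_mult intro: order_trans[OF abs_ge_zero Bij])
  have c1: "integrable M (\<lambda>\<omega>. (Y \<omega> $ i * Z \<omega> $ i $ j) * D \<omega> $ j)"
           "expectation (\<lambda>\<omega>. (Y \<omega> $ i * Z \<omega> $ i $ j) * D \<omega> $ j) = 0" for i j
  proof -
    have "indep_var borel (\<lambda>\<omega>. Y \<omega> $ i * Z \<omega> $ i $ j) borel (\<lambda>\<omega>. D \<omega> $ j)"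
      unfolding D_def
      by (rule indep_filtration_increment[OF st, of _ "\<lambda>x. x $ j"])
         (auto intro!: borel_measurable_times Ym Zm borel_measurable_vec_nth)
    note i = indep_var_integrable[OF this intYZ mom(1)] indep_var_lebesgue_integral[OF this intYZ mom(1)]
    show "integrable M (\<lambda>\<omega>. (Y \<omega> $ i * Z \<omega> $ i $ j) * D \<omega> $ j)"
         "expectation (\<lambda>\<omega>. (Y \<omega> $ i * Z \<omega> $ i $ j) * D \<omega> $ j) = 0"
      using i mom(2) by auto
  qed
  have c2: "integrable M (\<lambda>\<omega>. (Z \<omega> $ i $ j * Z \<omega> $ i $ k) * (D \<omega> $ j * D \<omega> $ k))"
           "expectation (\<lambda>\<omega>. (Z \<omega> $ i $ j * Z \<omega> $ i $ k) * (D \<omega> $ j * D \<omega> $ k)) =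
              (if j = k then expectation (\<lambda>\<omega>. (Z \<omega> $ i $ j)\<^sup>2) * (t - s) else 0)" for i j k
  proof -
    have "indep_var borel (\<lambda>\<omega>. Z \<omega> $ i $ j * Z \<omega> $ i $ k) borel (\<lambda>\<omega>. D \<omega> $ j * D \<omega> $ k)"
      unfolding D_def
      by (rule indep_filtration_increment[OF st, of _ "\<lambda>x. x $ j * x $ k"])
         (auto intro!: borel_measurable_times Zm borel_measurable_vec_nth)
    note i = indep_var_integrable[OF this intZZ mom(3)] indep_var_lebesgue_integral[OF this intZZ mom(3)]
    show "integrable M (\<lambda>\<omega>. (Z \<omega> $ i $ j * Z \<omega> $ i $ k) * (D \<omega> $ j * D \<omega> $ k))"
         "expectation (\<lambda>\<omega>. (Z \<omega> $ i $ j * Z \<omega> $ i $ k) * (D \<omega> $ j * D \<omega> $ k)) =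
              (if j = k then expectation (\<lambda>\<omega>. (Z \<omega> $ i $ j)\<^sup>2) * (t - s) else 0)"
      using i mom(4) by (auto simp: power2_eq_square)
  qed
  \<comment> \<open>Each summand now is an \<open>\<F> s\<close>-measurable factor times a monomial
    in the increment, the form to which \<open>c1\<close> and \<open>c2\<close> apply.\<close>
  have expand: "(norm (R \<omega>))\<^sup>2 = (norm (Y \<omega>))\<^sup>2 +
     (2 * (\<Sum>i\<in>UNIV. \<Sum>j\<in>UNIV. (Y \<omega> $ i * Z \<omega> $ i $ j) * D \<omega> $ j) +
     (\<Sum>i\<in>UNIV. \<Sum>j\<in>UNIV. \<Sum>k\<in>UNIV. (Z \<omega> $ i $ j * Z \<omega> $ i $ k) * (D \<omega> $ j * D \<omega> $ k)))" for \<omega>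
    unfolding R_def power2_norm_vec D_def[symmetric]
    by (simp add: matrix_vector_mult_def power2_sum sum.distrib sum_distrib_left)
       (simp add: power2_eq_square sum_product sum_distrib_left ac_simps)
  show "integrable M (\<lambda>\<omega>. (norm (R \<omega>))\<^sup>2)"
    unfolding expand
    by (intro Bochner_Integration.integrable_add integrable_mult_right Bochner_Integration.integrable_sum Y(2) c1 c2)
  have intZ2: "integrable M (\<lambda>\<omega>. (Z \<omega> $ i $ j)\<^sup>2)" for i j
    using intZZ[of i j j] by (simp add: power2_eq_square)
  show "expectation (\<lambda>\<omega>. (norm (R \<omega>))\<^sup>2) =
      expectation (\<lambda>\<omega>. (norm (Y \<omega>))\<^sup>2) + expectation (\<lambda>\<omega>. (norm (Z \<omega>))\<^sup>2) * (t - s)"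
    unfolding expand power2_norm_matrix
    by (simp add: Y(2) c1 c2 intZ2 sum_distrib_right)
qed

lemma simple_ito_isometry:
  fixes \<zeta> :: "nat \<Rightarrow> 'w \<Rightarrow> real^'m^'d"
  assumes q: "0 \<le> q 0" "\<And>k. k < n \<Longrightarrow> q k \<le> q (Suc k)"
    and meas: "\<And>k. k < n \<Longrightarrow> q k < q (Suc k) \<Longrightarrow> \<zeta> k \<in> borel_measurable (\<F> (q k))"
    and bdd: "\<And>k. k < n \<Longrightarrow> bounded (\<zeta> k ` space M)"
  defines "S \<equiv> \<lambda>m \<omega>. \<Sum>k<m. \<zeta> k \<omega> *v (W (q (Suc k)) \<omega> - W (q k) \<omega>)"
  shows "integrable M (\<lambda>\<omega>. (norm (S n \<omega>))\<^sup>2)"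
    and "expectation (\<lambda>\<omega>. (norm (S n \<omega>))\<^sup>2) =
      (\<Sum>k<n. expectation (\<lambda>\<omega>. (norm (\<zeta> k \<omega>))\<^sup>2) * (q (Suc k) - q k))"
proof -
  have q0: "0 \<le> q m" if "m \<le> n" for m
    using that by (induction m) (use q in \<open>auto intro: order_trans\<close>)
  have "S m \<in> borel_measurable (\<F> (q m)) \<and> integrable M (\<lambda>\<omega>. (norm (S m \<omega>))\<^sup>2) \<and>
      expectation (\<lambda>\<omega>. (norm (S m \<omega>))\<^sup>2) =
      (\<Sum>k<m. expectation (\<lambda>\<omega>. (norm (\<zeta> k \<omega>))\<^sup>2) * (q (Suc k) - q k))" if "m \<le> n" for m
    using that
  proof (induction m)
    case 0
    then show ?case by (simp add: S_def)
  next
    case (Suc m)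
    then have IH: "S m \<in> borel_measurable (\<F> (q m))" "integrable M (\<lambda>\<omega>. (norm (S m \<omega>))\<^sup>2)"
      "expectation (\<lambda>\<omega>. (norm (S m \<omega>))\<^sup>2) =
        (\<Sum>k<m. expectation (\<lambda>\<omega>. (norm (\<zeta> k \<omega>))\<^sup>2) * (q (Suc k) - q k))" and m: "m < n"
      by auto
    have SS: "S (Suc m) = (\<lambda>\<omega>. S m \<omega> + \<zeta> m \<omega> *v (W (q (Suc m)) \<omega> - W (q m) \<omega>))"
      by (simp add: S_def)
    show ?case
    proof (cases "q m < q (Suc m)")
      case True
      note Z = meas[OF m True] bdd[OF m]
      note i = integrable_add_matrix_increment[OF q0 True IH(1,2) Z]
      have "S (Suc m) \<in> borel_measurable (\<F> (q (Suc m)))"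
        unfolding SS using True m q0[of m]
        by (intro borel_measurable_add borel_measurable_matrix_vector_mult borel_measurable_diff W_filtration
          measurable_filtration_mono[OF IH(1)] measurable_filtration_mono[OF Z(1)]) auto
      then show ?thesis using i m IH(3) unfolding SS by auto
    next
      case False
      then have "q (Suc m) = q m" using q(2)[OF m] by simp
      then show ?thesis using IH by (simp add: SS)
    qed
  qed
  from this[of n] show "integrable M (\<lambda>\<omega>. (norm (S n \<omega>))\<^sup>2)"
    "expectation (\<lambda>\<omega>. (norm (S n \<omega>))\<^sup>2) =
      (\<Sum>k<n. expectation (\<lambda>\<omega>. (norm (\<zeta> k \<omega>))\<^sup>2) * (q (Suc k) - q k))"
    by auto
qed

text \<open>The integrand is stopped before its accumulated quadratic variation exceeds \<open>Q\<close>. As the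
  values of a simple integrand are known at the left endpoints, the stopped integrand is adapted.\<close>

lemma simple_integral_truncated_moment:
  fixes \<eta> :: "nat \<Rightarrow> 'w \<Rightarrow> real^'m^'d"
  assumes q: "0 \<le> q 0" "\<And>k. k < n \<Longrightarrow> q k \<le> q (Suc k)"
    and meas: "\<And>k. k < n \<Longrightarrow> q k < q (Suc k) \<Longrightarrow> \<eta> k \<in> borel_measurable (\<F> (q k))"
    and bdd: "\<And>k. k < n \<Longrightarrow> bounded (\<eta> k ` space M)"
    and Q: "0 \<le> Q"
  defines "V \<equiv> \<lambda>\<omega>. \<Sum>k<n. (norm (\<eta> k \<omega>))\<^sup>2 * (q (Suc k) - q k)"
    and "S \<equiv> \<lambda>\<omega>. \<Sum>k<n. \<eta> k \<omega> *v (W (q (Suc k)) \<omega> - W (q k) \<omega>)"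
  shows "(\<integral>\<^sup>+\<omega>. ennreal ((norm (S \<omega>))\<^sup>2) * indicator {\<omega>. V \<omega> \<le> Q} \<omega> \<partial>M) \<le>
    (\<integral>\<^sup>+\<omega>. ennreal (min (V \<omega>) Q) \<partial>M)"
proof -
  define a where "a k \<omega> = (norm (\<eta> k \<omega>))\<^sup>2 * (q (Suc k) - q k)" for k \<omega>
  define \<zeta> where "\<zeta> k \<omega> = (if (\<Sum>j\<le>k. a j \<omega>) \<le> Q then \<eta> k \<omega> else 0)" for k \<omega>
  define S' where "S' \<omega> = (\<Sum>k<n. \<zeta> k \<omega> *v (W (q (Suc k)) \<omega> - W (q k) \<omega>))" for \<omega>
  have a0: "0 \<le> a k \<omega>" if "k < n" for k \<omega>
    using q(2)[OF that] by (simp add: a_def)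
  have qmono: "q j \<le> q k" if "j \<le> k" "k \<le> n" for j k
    using that by (induction rule: dec_induct) (use q in \<open>auto intro: order_trans\<close>)
  have a_meas: "a j \<in> borel_measurable (\<F> (q k))" if "j \<le> k" "k < n" for j k
  proof (cases "q j < q (Suc j)")
    case True
    then have "\<eta> j \<in> borel_measurable (\<F> (q k))"
      using measurable_filtration_mono[OF meas qmono] that by simp
    then show ?thesis unfolding a_def by measurable
  next
    \<comment> \<open>On an empty interval the term is zero, so nothing has to be known about
      \<open>\<eta> j\<close>.\<close>
    case False
    then have "a j = (\<lambda>_. 0)" using q(2)[of j] that by (auto simp: a_def)
    then show ?thesis by simp
  qed
  have \<zeta>_meas: "\<zeta> k \<in> borel_measurable (\<F> (q k))" if "k < n" "q k < q (Suc k)" for k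
  proof -
    have [measurable]: "\<And>j. j \<in> {..k} \<Longrightarrow> a j \<in> borel_measurable (\<F> (q k))"
      "\<eta> k \<in> borel_measurable (\<F> (q k))"
      using a_meas meas that by auto
    show ?thesis unfolding \<zeta>_def by measurable
  qed
  have \<zeta>_bdd: "bounded (\<zeta> k ` space M)" if k: "k < n" for k
  proof -
    obtain B where "\<And>\<omega>. \<omega> \<in> space M \<Longrightarrow> norm (\<eta> k \<omega>) \<le> B"
      using bdd[OF k] by (auto simp: bounded_iff)
    then have "norm (\<zeta> k \<omega>) \<le> max B 0" if "\<omega> \<in> space M" for \<omega>
      using that by (auto simp: \<zeta>_def le_max_iff_disj)
    then show ?thesis by (auto simp: bounded_iff)
  qed
  have iso: "integrable M (\<lambda>\<omega>. (norm (S' \<omega>))\<^sup>2)"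
    "expectation (\<lambda>\<omega>. (norm (S' \<omega>))\<^sup>2) =
      (\<Sum>k<n. expectation (\<lambda>\<omega>. (norm (\<zeta> k \<omega>))\<^sup>2) * (q (Suc k) - q k))"
    unfolding S'_def by (rule simple_ito_isometry; fact q \<zeta>_meas \<zeta>_bdd)+
  \<comment> \<open>Where the total variation is at most \<open>Q\<close>, so is every partial sum,
    and stopping has removed nothing.\<close>
  have S_eq: "S \<omega> = S' \<omega>" if "V \<omega> \<le> Q" for \<omega>
  proof -
    have "(\<Sum>j\<le>k. a j \<omega>) \<le> Q" if "k < n" for k
    proof -
      have "(\<Sum>j\<le>k. a j \<omega>) \<le> (\<Sum>j<n. a j \<omega>)"
        using that a0 by (intro sum_mono2) auto
      then show ?thesis using \<open>V \<omega> \<le> Q\<close> by (simp add: V_def a_def)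
    qed
    then show ?thesis by (simp add: S_def S'_def \<zeta>_def)
  qed
  have \<zeta>_int: "integrable M (\<lambda>\<omega>. (norm (\<zeta> k \<omega>))\<^sup>2 * (q (Suc k) - q k))" if k: "k < n" for k
  proof (cases "q k < q (Suc k)")
    case True
    obtain B where B: "\<And>\<omega>. \<omega> \<in> space M \<Longrightarrow> norm (\<zeta> k \<omega>) \<le> B"
      using \<zeta>_bdd[OF k] by (auto simp: bounded_iff)
    have [measurable]: "\<zeta> k \<in> borel_measurable M"
      using \<zeta>_meas[OF k True] by (rule measurable_filtration_imp)
    have "integrable M (\<lambda>\<omega>. (norm (\<zeta> k \<omega>))\<^sup>2)"
      by (rule integrable_const_bound[of _ "B\<^sup>2"]) (auto intro!: AE_I2 power_mono B)
    then show ?thesis by simp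
  next
    case False
    then show ?thesis using q(2)[OF k] by simp
  qed
  have \<zeta>_sum: "(\<Sum>k<n. (norm (\<zeta> k \<omega>))\<^sup>2 * (q (Suc k) - q k)) \<le> min (V \<omega>) Q" for \<omega>
  proof -
    have "(\<Sum>k<n. (norm (\<zeta> k \<omega>))\<^sup>2 * (q (Suc k) - q k)) =
        (\<Sum>k<n. if (\<Sum>j\<le>k. a j \<omega>) \<le> Q then a k \<omega> else 0)"
      by (intro sum.cong) (auto simp: \<zeta>_def a_def)
    also have "\<dots> \<le> min (V \<omega>) Q"
      using sum_truncated_le_min[OF a0 Q] by (simp add: V_def a_def)
    finally show ?thesis .
  qed
  have "(\<integral>\<^sup>+\<omega>. ennreal ((norm (S \<omega>))\<^sup>2) * indicator {\<omega>. V \<omega> \<le> Q} \<omega> \<partial>M) \<le>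
      (\<integral>\<^sup>+\<omega>. ennreal ((norm (S' \<omega>))\<^sup>2) \<partial>M)"
    by (intro nn_integral_mono) (auto simp: indicator_def S_eq)
  also have "\<dots> = ennreal (expectation (\<lambda>\<omega>. (norm (S' \<omega>))\<^sup>2))"
    using iso(1) by (intro nn_integral_eq_integral) auto
  also have "expectation (\<lambda>\<omega>. (norm (S' \<omega>))\<^sup>2) =
      expectation (\<lambda>\<omega>. \<Sum>k<n. (norm (\<zeta> k \<omega>))\<^sup>2 * (q (Suc k) - q k))"
    unfolding iso(2) using \<zeta>_int by (subst Bochner_Integration.integral_sum) auto
  also have "ennreal \<dots> = (\<integral>\<^sup>+\<omega>. ennreal (\<Sum>k<n. (norm (\<zeta> k \<omega>))\<^sup>2 * (q (Suc k) - q k)) \<partial>M)"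
    using \<zeta>_int q(2) by (intro nn_integral_eq_integral[symmetric] Bochner_Integration.integrable_sum AE_I2 sum_nonneg) auto
  also have "\<dots> \<le> (\<integral>\<^sup>+\<omega>. ennreal (min (V \<omega>) Q) \<partial>M)"
    by (intro nn_integral_mono ennreal_leI \<zeta>_sum)
  finally show ?thesis .
qed

end

section \<open>Quadratic variation of simple processes, and measurability of time integrals\<close>

text \<open>The half-open partition intervals are disjoint, so at most one summand of the process is
  nonzero and no cross terms arise.\<close>

lemma simple_process_norm_square:
  assumes "\<And>k. k < n \<Longrightarrow> p k < p (Suc k)"
  shows "(norm (simple_process n p \<eta> s \<omega>))\<^sup>2 =
    (\<Sum>k<n. indicator {p k<..p (Suc k)} s * (norm (\<eta> k \<omega>))\<^sup>2)"
proof (cases "\<exists>k<n. s \<in> {p k<..p (Suc k)}")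
  case True
  then obtain k where k: "k < n" "s \<in> {p k<..p (Suc k)}" by blast
  have mono: "p i \<le> p j" if "i \<le> j" "j \<le> n" for i j
    using that
  proof (induction rule: dec_induct)
    case (step m)
    then show ?case using assms[of m] by auto
  qed simp
  have "indicat_real {p j<..p (Suc j)} s = of_bool (j = k)" if "j < n" for j
    using k mono[of "Suc k" j] mono[of "Suc j" k] that by (cases j k rule: linorder_cases) auto
  then show ?thesis
    using k by (simp add: simple_process_def if_distrib[of "\<lambda>x. x *\<^sub>R _"] if_distrib[of "\<lambda>x. x * _"] of_bool_def cong: if_cong)
next
  case False
  then have "indicat_real {p j<..p (Suc j)} s = 0" if "j < n" for j
    using that by (auto simp: indicator_def)
  then show ?thesis by (simp add: simple_process_def)
qed

text \<open>Links the sum that measures variation in the truncated moment bound, taken for the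
  partition cut at \<open>t\<close>, to an integral that can be compared with the one of
  \<open>H\<close>. Intervals beyond \<open>t\<close> receive length zero from the two
  minima.\<close>

lemma nn_integral_simple_process:
  assumes p: "0 \<le> p 0" "\<And>k. k < n \<Longrightarrow> p k < p (Suc k)" and t: "0 \<le> t"
  shows "(\<integral>\<^sup>+s\<in>{0..t}. ennreal ((norm (simple_process n p \<eta> s \<omega>))\<^sup>2) \<partial>lborel) =
    ennreal (\<Sum>k<n. (norm (\<eta> k \<omega>))\<^sup>2 * (min (p (Suc k)) t - min (p k) t))"
proof -
  have p0: "0 \<le> p k" if "k \<le> n" for k
    using that
  proof (induction k)
    case (Suc m)
    then show ?case using p(2)[of m] by auto
  qed (use p in simp)
  have "(\<integral>\<^sup>+s\<in>{0..t}. ennreal ((norm (simple_process n p \<eta> s \<omega>))\<^sup>2) \<partial>lborel) =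
     (\<integral>\<^sup>+s. (\<Sum>k<n. ennreal ((norm (\<eta> k \<omega>))\<^sup>2) * indicator {p k<..min (p (Suc k)) t} s) \<partial>lborel)"
  proof (rule nn_integral_cong)
    fix s :: real
    have "indicator {p k<..p (Suc k)} s * (norm (\<eta> k \<omega>))\<^sup>2 * indicator {0..t} s =
      (norm (\<eta> k \<omega>))\<^sup>2 * indicat_real {p k<..min (p (Suc k)) t} s" if "k < n" for k
      using p0[of k] that by (auto simp: indicator_def)
    then have "(norm (simple_process n p \<eta> s \<omega>))\<^sup>2 * indicator {0..t} s =
      (\<Sum>k<n. (norm (\<eta> k \<omega>))\<^sup>2 * indicator {p k<..min (p (Suc k)) t} s)"
      by (subst simple_process_norm_square[where n=n and p=p, OF p(2)])
         (auto simp: sum_distrib_right intro!: sum.cong simp del: sum_indicator_mult sum_mult_indicator)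
    then have "ennreal ((norm (simple_process n p \<eta> s \<omega>))\<^sup>2 * indicator {0..t} s) =
      (\<Sum>k<n. ennreal ((norm (\<eta> k \<omega>))\<^sup>2 * indicator {p k<..min (p (Suc k)) t} s))"
      by (simp add: sum_ennreal)
    then show "ennreal ((norm (simple_process n p \<eta> s \<omega>))\<^sup>2) * indicator {0..t} s =
      (\<Sum>k<n. ennreal ((norm (\<eta> k \<omega>))\<^sup>2) * indicator {p k<..min (p (Suc k)) t} s)"
      by (simp add: ennreal_mult' ennreal_indicator)
  qed
  also have "\<dots> = (\<Sum>k<n. ennreal ((norm (\<eta> k \<omega>))\<^sup>2) * emeasure lborel {p k<..min (p (Suc k)) t})"
    by (subst nn_integral_sum) (auto simp: nn_integral_cmult_indicator)
  also have "\<dots> = (\<Sum>k<n. ennreal ((norm (\<eta> k \<omega>))\<^sup>2 * (min (p (Suc k)) t - min (p k) t)))"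
  proof (rule sum.cong)
    fix k assume "k \<in> {..<n}"
    then have "p k < p (Suc k)" using p by auto
    then have "emeasure lborel {p k<..min (p (Suc k)) t} = ennreal (min (p (Suc k)) t - min (p k) t)"
      by (cases "p k \<le> t") (auto simp: min_def)
    then show "ennreal ((norm (\<eta> k \<omega>))\<^sup>2) * emeasure lborel {p k<..min (p (Suc k)) t} =
      ennreal ((norm (\<eta> k \<omega>))\<^sup>2 * (min (p (Suc k)) t - min (p k) t))"
      by (simp add: ennreal_mult')
  qed simp
  also have "\<dots> = ennreal (\<Sum>k<n. (norm (\<eta> k \<omega>))\<^sup>2 * (min (p (Suc k)) t - min (p k) t))"
    by (intro sum_ennreal mult_nonneg_nonneg) (auto simp: min_def dest!: p(2))
  finally show ?thesis .
qed

text \<open>Progressive measurability says nothing about times outside \<open>{0..T}\<close>. The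
  measurability part of Tonelli's theorem is therefore applied to Lebesgue measure restricted to
  this interval, which is still sigma-finite.\<close>

lemma borel_measurable_set_nn_integral_Icc:
  fixes g :: "real \<Rightarrow> 'a \<Rightarrow> ennreal"
  assumes g: "(\<lambda>(s, \<omega>). g s \<omega>) \<in> borel_measurable (restrict_space borel {0..T} \<Otimes>\<^sub>M N)" and t: "t \<le> T"
  shows "(\<lambda>\<omega>. \<integral>\<^sup>+s\<in>{0..t}. g s \<omega> \<partial>lborel) \<in> borel_measurable N"
proof -
  let ?L = "restrict_space lborel {0..T}"
  interpret L: sigma_finite_measure ?L
    by (rule sigma_finite_measure_restrict_space) (auto intro: sigma_finite_lborel)
  have [measurable_cong]: "sets ?L = sets (restrict_space borel {0..T})"
    by (rule sets_restrict_space_cong) simp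
  have id: "(\<lambda>x. x) \<in> ?L \<rightarrow>\<^sub>M borel"
    by (rule measurable_restrict_space1) simp
  have "(\<lambda>(\<omega>, s). (s, \<omega>)) \<in> N \<Otimes>\<^sub>M ?L \<rightarrow>\<^sub>M restrict_space borel {0..T} \<Otimes>\<^sub>M N"
    by measurable
  from measurable_compose[OF this g]
  have [measurable]: "(\<lambda>(\<omega>, s). g s \<omega>) \<in> borel_measurable (N \<Otimes>\<^sub>M ?L)"
    by (simp add: case_prod_unfold)
  have [measurable]: "(\<lambda>x. indicator {0..t} (snd x) :: ennreal) \<in> borel_measurable (N \<Otimes>\<^sub>M ?L)"
    by (rule measurable_compose[OF measurable_compose[OF measurable_snd id]]) simp
  have "(\<lambda>\<omega>. \<integral>\<^sup>+s. g s \<omega> * indicator {0..t} s \<partial>?L) \<in> borel_measurable N"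
    by (rule L.borel_measurable_nn_integral) (simp add: case_prod_unfold)
  also have "(\<lambda>\<omega>. \<integral>\<^sup>+s. g s \<omega> * indicator {0..t} s \<partial>?L) = (\<lambda>\<omega>. \<integral>\<^sup>+s\<in>{0..t}. g s \<omega> \<partial>lborel)"
    using t by (auto simp: nn_integral_restrict_space indicator_def intro!: ext nn_integral_cong)
  finally show ?thesis .
qed

text \<open>Turns convergence in probability into almost sure convergence: \<open>r i\<close> is
  chosen such that the bad event at tolerance \<open>(1/2) ^ i\<close> has probability below
  \<open>(1/2) ^ i\<close>, and Borel-Cantelli applies. Monotonicity of \<open>r\<close> is not
  asked for; the shrinking tolerance already forces convergence along \<open>r\<close>.\<close>

lemma (in prob_space) AE_eventually_notin_diagonal:
  fixes B :: "real \<Rightarrow> nat \<Rightarrow> 'a set"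
  assumes B: "\<And>e l. 0 < e \<Longrightarrow> B e l \<in> events"
    and lim: "\<And>e. 0 < e \<Longrightarrow> (\<lambda>l. prob (B e l)) \<longlonglongrightarrow> 0"
  obtains r where "AE \<omega> in M. \<forall>\<^sub>F i in sequentially. \<omega> \<notin> B ((1/2) ^ i) (r i)"
proof -
  have "\<exists>l. prob (B ((1/2) ^ i) l) < (1/2) ^ i" for i :: nat
    using order_tendstoD(2)[OF lim, of "(1/2)^i" "(1/2)^i"]
    by (auto simp: eventually_sequentially)
  then obtain r where r: "\<And>i. prob (B ((1/2) ^ i) (r i)) < (1/2) ^ i" by metis
  have "summable (\<lambda>i. prob (B ((1/2) ^ i) (r i)))"
    by (rule summable_comparison_test'[of "\<lambda>i. (1/2) ^ i"])
       (use r in \<open>auto simp: summable_geometric less_imp_le\<close>)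
  then have "AE \<omega> in M. \<forall>\<^sub>F i in sequentially. \<omega> \<in> space M - B ((1/2) ^ i) (r i)"
    by (intro borel_cantelli_AE1) (auto simp: B less_top[symmetric])
  then have "AE \<omega> in M. \<forall>\<^sub>F i in sequentially. \<omega> \<notin> B ((1/2) ^ i) (r i)"
    by (auto elim!: eventually_mono)
  then show ?thesis by (rule that)
qed

lemma power2_norm_le_add_diff: "(norm (a::'a::real_inner))\<^sup>2 \<le> 2 * (norm b)\<^sup>2 + 2 * (norm (a - b))\<^sup>2"
proof -
  have "norm a \<le> norm b + norm (a - b)" by norm
  then have "(norm a)\<^sup>2 \<le> (norm b + norm (a - b))\<^sup>2" by (intro power_mono) auto
  also have "\<dots> \<le> 2 * (norm b)\<^sup>2 + 2 * (norm (a - b))\<^sup>2"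
    using sum_squares_bound[of "norm b" "norm (a - b)"] by (simp add: power2_sum)
  finally show ?thesis .
qed

text \<open>If both \<open>x\<close> and \<open>y\<close> are at most \<open>q\<close>, the
  right-hand side is \<open>2 * x + 2 * y\<close>; otherwise one of its minima equals
  \<open>q\<close>. Splitting the truncation keeps the approximation error truncated as well, so
  that dominated convergence can remove it.\<close>

lemma ennreal_min_add_le: "min (2 * x + 2 * y) q \<le> 2 * min x q + 2 * min y (q :: ennreal)"
proof (cases "x \<le> q \<and> y \<le> q")
  case False
  then have "q \<le> min x q + min y q"
    by (auto simp: min_def intro: add_increasing add_increasing2)
  also have "\<dots> \<le> 2 * min x q + 2 * min y q"
    by (simp add: mult_2 add_mono add_increasing2)
  finally show ?thesis by (simp add: min_le_iff_disj)
qed (simp add: min_le_iff_disj)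

lemma (in brownian) progressively_measurable_imp_borel_measurable:
  assumes "progressively_measurable \<F> T H" "0 \<le> T"
  shows "(\<lambda>(s, \<omega>). H s \<omega>) \<in> borel_measurable (restrict_space borel {0..T} \<Otimes>\<^sub>M M)"
proof -
  let ?R = "restrict_space borel {0..T} :: real measure"
  have "(\<lambda>(s, \<omega>). H s \<omega>) \<in> borel_measurable (?R \<Otimes>\<^sub>M \<F> T)"
    using assms by (auto simp: progressively_measurable_def)
  moreover have "(\<lambda>x. (fst x, snd x)) \<in> ?R \<Otimes>\<^sub>M M \<rightarrow>\<^sub>M ?R \<Otimes>\<^sub>M \<F> T"
  proof (intro measurable_Pair measurable_fst)
    have "(\<lambda>\<omega>. \<omega>) \<in> M \<rightarrow>\<^sub>M \<F> T"
      by (rule measurable_filtration_imp[of _ T]) simp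
    from measurable_compose[OF measurable_snd this] show "snd \<in> ?R \<Otimes>\<^sub>M M \<rightarrow>\<^sub>M \<F> T" .
  qed
  ultimately show ?thesis
    using measurable_compose[of "\<lambda>x. (fst x, snd x)"] by (simp add: case_prod_unfold)
qed

text \<open>Both factors 2 come from comparing the variation \<open>VS\<close> of the approximants
  with \<open>V\<close>. The strict inequality in the event leaves room for the approximation error,
  so that almost every point of the event eventually satisfies \<open>VS \<le> Q\<close>.\<close>

lemma (in brownian) ito_integral_truncated_moment:
  fixes H :: "real \<Rightarrow> 'w \<Rightarrow> real^'m^'d"
  assumes ito: "has_ito_integral M \<F> W T H I" and t: "t \<in> {0..T}" and Q: "0 < Q"
  defines "V \<equiv> \<lambda>\<omega>. \<integral>\<^sup>+s\<in>{0..t}. ennreal ((norm (H s \<omega>))\<^sup>2) \<partial>lborel"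
  shows "(\<integral>\<^sup>+\<omega>. ennreal ((norm (I t \<omega>))\<^sup>2) * indicator {\<omega>. 2 * V \<omega> < ennreal Q} \<omega> \<partial>M) \<le>
    2 * (\<integral>\<^sup>+\<omega>. min (V \<omega>) (ennreal Q) \<partial>M)"
proof -
  let ?R = "restrict_space borel {0..T} :: real measure"
  obtain n p \<eta> where simple: "\<And>l. simple_integrand M \<F> T (n l) (p l) (\<eta> l)"
    and conv_H: "\<And>e. 0 < e \<Longrightarrow> (\<lambda>l. prob {\<omega> \<in> space M. ennreal e <
        (\<integral>\<^sup>+s\<in>{0..T}. ennreal ((norm (simple_process (n l) (p l) (\<eta> l) s \<omega> - H s \<omega>))\<^sup>2)
           \<partial>lborel)}) \<longlonglongrightarrow> 0"
    and conv_I: "\<And>e. 0 < e \<Longrightarrow> (\<lambda>l. prob {\<omega> \<in> space M.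
        e < norm (simple_integral W (n l) (p l) (\<eta> l) t \<omega> - I t \<omega>)}) \<longlonglongrightarrow> 0"
    using ito t unfolding has_ito_integral_def by blast
  have [measurable]: "I t \<in> borel_measurable M"
    using ito t by (auto simp: has_ito_integral_def)
  have H_meas [measurable]: "(\<lambda>(s, \<omega>). H s \<omega>) \<in> borel_measurable (?R \<Otimes>\<^sub>M M)"
    using ito t by (intro progressively_measurable_imp_borel_measurable) (auto simp: has_ito_integral_def)
  define D where "D l \<omega> = (\<integral>\<^sup>+s\<in>{0..T}. ennreal ((norm (simple_process (n l) (p l) (\<eta> l) s \<omega> - H s \<omega>))\<^sup>2)
           \<partial>lborel)" for l \<omega>
  define S where "S l = simple_integral W (n l) (p l) (\<eta> l) t" for l
  define VS where "VS l \<omega> = (\<Sum>k<n l. (norm (\<eta> l k \<omega>))\<^sup>2 * (min (p l (Suc k)) t - min (p l k) t))" for l \<omega>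
  have p: "p l 0 = 0" "p l (n l) = T" "\<And>k. k < n l \<Longrightarrow> p l k < p l (Suc k)"
    and \<eta>F: "\<And>k. k < n l \<Longrightarrow> \<eta> l k \<in> borel_measurable (\<F> (p l k))"
    and \<eta>_bdd: "\<And>k. k < n l \<Longrightarrow> bounded (\<eta> l k ` space M)" for l
    using simple[of l] by (auto simp: simple_integrand_def)
  have p0: "0 \<le> p l k" if "k \<le> n l" for l k
    using that
  proof (induction k)
    case (Suc m)
    then show ?case using p(3)[of m l] by auto
  qed (use p in simp)
  have \<eta>M: "\<eta> l k \<in> borel_measurable M" if "k < n l" for l k
    using \<eta>F[OF that] by (rule measurable_filtration_imp)
  have S_meas [measurable]: "S l \<in> borel_measurable M" for l
    unfolding S_def simple_integral_def using t p0
    by (intro borel_measurable_sum borel_measurable_matrix_vector_mult borel_measurable_diff W_measurable \<eta>M) auto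
  have VS_meas [measurable]: "VS l \<in> borel_measurable M" for l
    unfolding VS_def
  proof (intro borel_measurable_sum)
    fix k assume "k \<in> {..<n l}"
    then have [measurable]: "\<eta> l k \<in> borel_measurable M" using \<eta>M by simp
    show "(\<lambda>\<omega>. (norm (\<eta> l k \<omega>))\<^sup>2 * (min (p l (Suc k)) t - min (p l k) t)) \<in> borel_measurable M"
      by measurable
  qed
  have id: "(\<lambda>x. x) \<in> ?R \<rightarrow>\<^sub>M borel"
    by (rule measurable_restrict_space1) simp
  have simple_meas [measurable]:
    "(\<lambda>(s, \<omega>). simple_process (n l) (p l) (\<eta> l) s \<omega>) \<in> borel_measurable (?R \<Otimes>\<^sub>M M)" for l
    unfolding simple_process_def case_prod_unfold
    by (intro borel_measurable_sum borel_measurable_scaleR measurable_compose[OF measurable_snd \<eta>M]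
      measurable_compose[OF measurable_compose[OF measurable_fst id]]) auto
  have D_meas [measurable]: "D l \<in> borel_measurable M" for l
    unfolding D_def by (rule borel_measurable_set_nn_integral_Icc[of _ T]) measurable
  have V_meas [measurable]: "V \<in> borel_measurable M"
    unfolding V_def using t by (intro borel_measurable_set_nn_integral_Icc[of _ T]) auto
  have VS_eq: "ennreal (VS l \<omega>) = (\<integral>\<^sup>+s\<in>{0..t}. ennreal ((norm (simple_process (n l) (p l) (\<eta> l) s \<omega>))\<^sup>2) \<partial>lborel)" for l \<omega>
    unfolding VS_def using p t by (intro nn_integral_simple_process[symmetric]) auto
  \<comment> \<open>An upper bound at every index suffices for the argument, so convergence of
    \<open>VS\<close> to \<open>V\<close> need not be established.\<close>
  have VS_le: "ennreal (VS l \<omega>) \<le> 2 * V \<omega> + 2 * D l \<omega>" if \<omega>: "\<omega> \<in> space M" for l \<omega>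
  proof -
    have "ennreal (VS l \<omega>) \<le> (\<integral>\<^sup>+s. 2 * (ennreal ((norm (H s \<omega>))\<^sup>2) * indicator {0..t} s) +
        2 * (ennreal ((norm (simple_process (n l) (p l) (\<eta> l) s \<omega> - H s \<omega>))\<^sup>2) * indicator {0..T} s) \<partial>lborel)"
      unfolding VS_eq
    proof (intro nn_integral_mono)
      fix s
      have "ennreal ((norm (simple_process (n l) (p l) (\<eta> l) s \<omega>))\<^sup>2) \<le>
        ennreal (2 * (norm (H s \<omega>))\<^sup>2 + 2 * (norm (simple_process (n l) (p l) (\<eta> l) s \<omega> - H s \<omega>))\<^sup>2)"
        by (intro ennreal_leI power2_norm_le_add_diff)
      also have "\<dots> = 2 * ennreal ((norm (H s \<omega>))\<^sup>2) +
          2 * ennreal ((norm (simple_process (n l) (p l) (\<eta> l) s \<omega> - H s \<omega>))\<^sup>2)"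
        by (simp add: ennreal_mult')
      finally show "ennreal ((norm (simple_process (n l) (p l) (\<eta> l) s \<omega>))\<^sup>2) * indicator {0..t} s \<le>
        2 * (ennreal ((norm (H s \<omega>))\<^sup>2) * indicator {0..t} s) +
        2 * (ennreal ((norm (simple_process (n l) (p l) (\<eta> l) s \<omega> - H s \<omega>))\<^sup>2) * indicator {0..T} s)"
        using t by (auto simp: indicator_def)
    qed
    also have "\<dots> = 2 * V \<omega> + 2 * D l \<omega>"
    proof -
      have pair: "(\<lambda>s. (s, \<omega>)) \<in> ?R \<rightarrow>\<^sub>M ?R \<Otimes>\<^sub>M M"
        using \<omega> by simp
      have [measurable]: "(\<lambda>s. H s \<omega>) \<in> borel_measurable ?R"
        "(\<lambda>s. simple_process (n l) (p l) (\<eta> l) s \<omega>) \<in> borel_measurable ?R"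
        using measurable_compose[OF pair H_meas] measurable_compose[OF pair simple_meas[of l]] by simp_all
      \<comment> \<open>Measurability in time is known on \<open>{0..T}\<close> only; the indicator
        of a subset extends the function by zero to the whole line.\<close>
      have ind: "(\<lambda>s. f s * indicator A s) \<in> borel_measurable lborel"
        if f: "f \<in> borel_measurable ?R" and A: "A \<subseteq> {0..T}" "A \<in> sets borel" for f :: "real \<Rightarrow> ennreal" and A
      proof -
        have "(\<lambda>s. f s * indicator {0..T} s) \<in> borel_measurable borel"
          using f by (subst (asm) borel_measurable_restrict_space_iff_ennreal) auto
        then have "(\<lambda>s. f s * indicator {0..T} s * indicator A s) \<in> borel_measurable borel"
          using A by measurable
        also have "(\<lambda>s. f s * indicator {0..T} s * indicator A s) = (\<lambda>s. f s * indicator A s)"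
          by (rule ext) (use A(1) in \<open>auto split: split_indicator\<close>)
        finally show ?thesis by simp
      qed
      have [measurable]:
        "(\<lambda>s. ennreal ((norm (H s \<omega>))\<^sup>2) * indicator {0..t} s) \<in> borel_measurable lborel"
        "(\<lambda>s. ennreal ((norm (simple_process (n l) (p l) (\<eta> l) s \<omega> - H s \<omega>))\<^sup>2) * indicator {0..T} s)
          \<in> borel_measurable lborel"
        using t by (intro ind; measurable; simp)+
      show ?thesis
        unfolding V_def D_def by (subst nn_integral_add) (measurable, simp add: nn_integral_cmult)
    qed
    finally show ?thesis .
  qed
  \<comment> \<open>A single bad event for the error of the integrand and that of the integral, so
    that one choice of \<open>r\<close> makes both converge.\<close>
  define B where "B e l = {\<omega> \<in> space M. ennreal e < D l \<omega>} \<union> {\<omega> \<in> space M. e < norm (S l \<omega> - I t \<omega>)}" for e l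
  have B_events: "B e l \<in> events" for e l
    unfolding B_def by measurable
  have B_lim: "(\<lambda>l. prob (B e l)) \<longlonglongrightarrow> 0"
    if "0 < e" for e
  proof (rule tendsto_sandwich[OF _ _ tendsto_const])
    show "(\<lambda>l. prob {\<omega> \<in> space M. ennreal e < D l \<omega>} + prob {\<omega> \<in> space M. e < norm (S l \<omega> - I t \<omega>)}) \<longlonglongrightarrow> 0"
      using tendsto_add[OF conv_H[OF that] conv_I[OF that]] by (simp add: D_def S_def)
    show "\<forall>\<^sub>F l in sequentially. prob (B e l)
      \<le> prob {\<omega> \<in> space M. ennreal e < D l \<omega>} + prob {\<omega> \<in> space M. e < norm (S l \<omega> - I t \<omega>)}"
      unfolding B_def by (intro always_eventually allI measure_Un_le) measurable
  qed simp
  obtain r where r: "AE \<omega> in M. \<forall>\<^sub>F i in sequentially. \<omega> \<notin> B ((1/2) ^ i) (r i)"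
    by (rule AE_eventually_notin_diagonal[OF B_events B_lim])
  have half: "(\<lambda>i. (1/2 :: real) ^ i) \<longlonglongrightarrow> 0"
    by (rule LIMSEQ_power_zero) simp
  have half': "(\<lambda>i. ennreal ((1/2) ^ i)) \<longlonglongrightarrow> 0"
    using tendsto_ennrealI[OF half] by simp
  have ae: "AE \<omega> in M. (\<lambda>i. D (r i) \<omega>) \<longlonglongrightarrow> 0 \<and> (\<lambda>i. S (r i) \<omega>) \<longlonglongrightarrow> I t \<omega>"
    using r AE_space
  proof eventually_elim
    case (elim \<omega>)
    have "(\<lambda>i. D (r i) \<omega>) \<longlonglongrightarrow> 0"
      by (rule tendsto_sandwich[OF _ _ tendsto_const half'])
         (use elim in \<open>auto simp: B_def not_less elim!: eventually_mono\<close>)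
    moreover have "(\<lambda>i. norm (S (r i) \<omega> - I t \<omega>)) \<longlonglongrightarrow> 0"
      by (rule tendsto_sandwich[OF _ _ tendsto_const half])
         (use elim in \<open>auto simp: B_def not_less elim!: eventually_mono\<close>)
    ultimately show ?case
      by (auto simp: LIM_zero_iff intro: LIM_zero_cancel tendsto_norm_zero_cancel)
  qed
  define G where "G i \<omega> = ennreal ((norm (S (r i) \<omega>))\<^sup>2) * indicator {\<omega>. VS (r i) \<omega> \<le> Q} \<omega>" for i \<omega>
  have [measurable]: "G i \<in> borel_measurable M" for i
    unfolding G_def by measurable
  have "(\<integral>\<^sup>+\<omega>. ennreal ((norm (I t \<omega>))\<^sup>2) * indicator {\<omega>. 2 * V \<omega> < ennreal Q} \<omega> \<partial>M) \<le>
    (\<integral>\<^sup>+\<omega>. liminf (\<lambda>i. G i \<omega>) \<partial>M)"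
  proof (intro nn_integral_mono_AE, use ae AE_space in eventually_elim)
    case (elim \<omega>)
    show ?case
    proof (cases "2 * V \<omega> < ennreal Q")
      case True
      have "(\<lambda>i. 2 * V \<omega> + 2 * D (r i) \<omega>) \<longlonglongrightarrow> 2 * V \<omega> + 2 * 0"
        using elim by (intro tendsto_add tendsto_const ennreal_tendsto_cmult) auto
      then have "\<forall>\<^sub>F i in sequentially. 2 * V \<omega> + 2 * D (r i) \<omega> < ennreal Q"
        using True by (intro order_tendstoD) auto
      then have "\<forall>\<^sub>F i in sequentially. VS (r i) \<omega> \<le> Q"
      proof eventually_elim
        case (elim i)
        then have "ennreal (VS (r i) \<omega>) \<le> ennreal Q"
          using VS_le[OF \<open>\<omega> \<in> space M\<close>, of "r i"] by auto
        then show ?case using Q by simp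
      qed
      then have "\<forall>\<^sub>F i in sequentially. ennreal ((norm (S (r i) \<omega>))\<^sup>2) = G i \<omega>"
        by (auto simp: G_def elim!: eventually_mono)
      moreover have "(\<lambda>i. ennreal ((norm (S (r i) \<omega>))\<^sup>2)) \<longlonglongrightarrow> ennreal ((norm (I t \<omega>))\<^sup>2)"
        using elim by (intro tendsto_ennrealI tendsto_power tendsto_norm) auto
      ultimately have "(\<lambda>i. G i \<omega>) \<longlonglongrightarrow> ennreal ((norm (I t \<omega>))\<^sup>2)"
        by (rule Lim_transform_eventually[rotated])
      then have "liminf (\<lambda>i. G i \<omega>) = ennreal ((norm (I t \<omega>))\<^sup>2)"
        by (intro lim_imp_Liminf) auto
      then show ?thesis by (auto simp: indicator_def)
    qed simp
  qed
  also have "\<dots> \<le> liminf (\<lambda>i. \<integral>\<^sup>+\<omega>. G i \<omega> \<partial>M)"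
    by (rule nn_integral_liminf) simp
  also have "\<dots> \<le> liminf (\<lambda>i. 2 * (\<integral>\<^sup>+\<omega>. min (V \<omega>) (ennreal Q) \<partial>M) + 2 * (\<integral>\<^sup>+\<omega>. min (D (r i) \<omega>) (ennreal Q) \<partial>M))"
  proof (intro Liminf_mono always_eventually allI)
    fix i
    have "(\<integral>\<^sup>+\<omega>. G i \<omega> \<partial>M) \<le> (\<integral>\<^sup>+\<omega>. ennreal (min (VS (r i) \<omega>) Q) \<partial>M)"
      unfolding G_def S_def simple_integral_def VS_def
    proof (rule simple_integral_truncated_moment)
      \<comment> \<open>A nonempty interval of the cut partition starts at an original partition
        point, where \<open>\<eta>\<close> is measurable.\<close>
      fix k assume k: "k < n (r i)" "min (p (r i) k) t < min (p (r i) (Suc k)) t"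
      then have "min (p (r i) k) t = p (r i) k" by auto
      then show "\<eta> (r i) k \<in> borel_measurable (\<F> (min (p (r i) k) t))" using \<eta>F[OF k(1)] by (simp only:)
    next
      fix k assume "k < n (r i)"
      then show "min (p (r i) k) t \<le> min (p (r i) (Suc k)) t"
        using p(3)[of k "r i"] by (auto simp: min_def)
    qed (use p t Q \<eta>_bdd in auto)
    also have "\<dots> \<le> (\<integral>\<^sup>+\<omega>. 2 * min (V \<omega>) (ennreal Q) + 2 * min (D (r i) \<omega>) (ennreal Q) \<partial>M)"
    proof (intro nn_integral_mono)
      fix \<omega> assume \<omega>: "\<omega> \<in> space M"
      have "ennreal (min (VS (r i) \<omega>) Q) = min (ennreal (VS (r i) \<omega>)) (ennreal Q)"
        using Q by (auto simp: min_def)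
      also have "\<dots> \<le> min (2 * V \<omega> + 2 * D (r i) \<omega>) (ennreal Q)"
        using VS_le[OF \<omega>] by (intro min.mono) auto
      finally show "ennreal (min (VS (r i) \<omega>) Q) \<le> 2 * min (V \<omega>) (ennreal Q) + 2 * min (D (r i) \<omega>) (ennreal Q)"
        using ennreal_min_add_le order_trans by blast
    qed
    also have "\<dots> = 2 * (\<integral>\<^sup>+\<omega>. min (V \<omega>) (ennreal Q) \<partial>M) + 2 * (\<integral>\<^sup>+\<omega>. min (D (r i) \<omega>) (ennreal Q) \<partial>M)"
      by (simp add: nn_integral_add nn_integral_cmult)
    finally show "(\<integral>\<^sup>+\<omega>. G i \<omega> \<partial>M) \<le> 2 * (\<integral>\<^sup>+\<omega>. min (V \<omega>) (ennreal Q) \<partial>M) + 2 * (\<integral>\<^sup>+\<omega>. min (D (r i) \<omega>) (ennreal Q) \<partial>M)" .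
  qed
  also have "\<dots> = 2 * (\<integral>\<^sup>+\<omega>. min (V \<omega>) (ennreal Q) \<partial>M)"
  proof (rule lim_imp_Liminf)
    \<comment> \<open>The untruncated error \<open>D\<close> converges almost surely but has no
      integrable majorant at hand; its truncation is dominated by the constant
      \<open>Q\<close>.\<close>
    have "(\<lambda>i. \<integral>\<^sup>+\<omega>. min (D (r i) \<omega>) (ennreal Q) \<partial>M) \<longlonglongrightarrow> (\<integral>\<^sup>+\<omega>. 0 \<partial>M)"
    proof (rule nn_integral_dominated_convergence[where w="\<lambda>_. ennreal Q"])
      show "AE \<omega> in M. (\<lambda>i. min (D (r i) \<omega>) (ennreal Q)) \<longlonglongrightarrow> 0"
        using ae
      proof eventually_elim
        case (elim \<omega>)
        then have "(\<lambda>i. min (D (r i) \<omega>) (ennreal Q)) \<longlonglongrightarrow> min 0 (ennreal Q)"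
          by (intro tendsto_min tendsto_const) auto
        then show ?case by simp
      qed
    qed (auto simp: emeasure_space_1)
    then have "(\<lambda>i. 2 * (\<integral>\<^sup>+\<omega>. min (V \<omega>) (ennreal Q) \<partial>M) + 2 * (\<integral>\<^sup>+\<omega>. min (D (r i) \<omega>) (ennreal Q) \<partial>M))
      \<longlonglongrightarrow> 2 * (\<integral>\<^sup>+\<omega>. min (V \<omega>) (ennreal Q) \<partial>M) + 2 * (\<integral>\<^sup>+\<omega>. 0 \<partial>M)"
      by (intro tendsto_add tendsto_const ennreal_tendsto_cmult) auto
    then show "(\<lambda>i. 2 * (\<integral>\<^sup>+\<omega>. min (V \<omega>) (ennreal Q) \<partial>M) + 2 * (\<integral>\<^sup>+\<omega>. min (D (r i) \<omega>) (ennreal Q) \<partial>M))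
      \<longlonglongrightarrow> 2 * (\<integral>\<^sup>+\<omega>. min (V \<omega>) (ennreal Q) \<partial>M)"
      by simp
  qed simp
  finally show ?thesis .
qed

subsection \<open>Second moments of solutions of stochastic differential equations\<close>

text \<open>Rounding the time down to the grid of mesh \<open>1 / (n + 1)\<close> leaves countably
  many times, hence a jointly measurable process; continuity of the paths gives pointwise
  convergence.\<close>

lemma borel_measurable_continuous_process:
  fixes Y :: "real \<Rightarrow> 'a \<Rightarrow> 'b::metric_space"
  assumes meas: "\<And>t. Y t \<in> borel_measurable N"
    and cont: "\<And>\<omega>. \<omega> \<in> space N \<Longrightarrow> continuous_on UNIV (\<lambda>t. Y t \<omega>)"
  shows "(\<lambda>(t, \<omega>). Y t \<omega>) \<in> borel_measurable (borel \<Otimes>\<^sub>M N)"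
proof (rule borel_measurable_LIMSEQ_metric)
  let ?r = "\<lambda>n t :: real. real_of_int \<lfloor>t * real (Suc n)\<rfloor> / real (Suc n)"
  fix n
  have "(\<lambda>x. Y (real_of_int i / real (Suc n)) (snd x)) \<in> borel_measurable (borel \<Otimes>\<^sub>M N)" for i
    by (rule measurable_compose[OF measurable_snd meas])
  moreover have "(\<lambda>x. \<lfloor>fst x * real (Suc n)\<rfloor>) \<in> borel \<Otimes>\<^sub>M N \<rightarrow>\<^sub>M count_space UNIV"
    by measurable
  ultimately show "(\<lambda>x. Y (?r n (fst x)) (snd x)) \<in> borel_measurable (borel \<Otimes>\<^sub>M N)"
    by (rule measurable_compose_countable)
next
  let ?r = "\<lambda>n t :: real. real_of_int \<lfloor>t * real (Suc n)\<rfloor> / real (Suc n)"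
  fix x :: "real \<times> 'a" assume x: "x \<in> space (borel \<Otimes>\<^sub>M N)"
  obtain t :: real and \<omega> where [simp]: "x = (t, \<omega>)" by (cases x)
  have "(\<lambda>n. ?r n t) \<longlonglongrightarrow> t"
  proof (rule tendsto_sandwich[of "\<lambda>n. t - inverse (real (Suc n))" _ _ "\<lambda>_. t"])
    have "t * real (Suc n) - 1 \<le> real_of_int \<lfloor>t * real (Suc n)\<rfloor>" for n
      by linarith
    then have "t - inverse (real (Suc n)) \<le> ?r n t" for n
      by (subst pos_le_divide_eq) (auto simp: left_diff_distrib simp del: of_nat_Suc)
    then show "\<forall>\<^sub>F n in sequentially. t - inverse (real (Suc n)) \<le> ?r n t" by simp
    have "?r n t \<le> t" for n
      by (subst divide_le_eq) auto
    then show "\<forall>\<^sub>F n in sequentially. ?r n t \<le> t" by simp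
    show "(\<lambda>n. t - inverse (real (Suc n))) \<longlonglongrightarrow> t"
      using tendsto_diff[OF tendsto_const[of t] LIMSEQ_inverse_real_of_nat] by simp
  qed simp
  then have "(\<lambda>n. Y (?r n t) \<omega>) \<longlonglongrightarrow> Y t \<omega>"
    using cont[of \<omega>] x
    by (intro continuous_on_tendsto_compose[of UNIV "\<lambda>t. Y t \<omega>"]) (auto simp: space_pair_measure)
  then show "(\<lambda>n. Y (?r n (fst x)) (snd x)) \<longlonglongrightarrow> (case x of (t, \<omega>) \<Rightarrow> Y t \<omega>)"
    by simp
qed

text \<open>Paths are continuous only on \<open>{0..T}\<close>. Freezing them at the endpoints
  yields a process on the whole time line that agrees with \<open>X\<close> on the interval.\<close>

lemma borel_measurable_continuous_process_Icc:
  fixes X :: "real \<Rightarrow> 'a \<Rightarrow> 'b::metric_space"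
  assumes T: "0 \<le> T" and meas: "\<And>t. t \<in> {0..T} \<Longrightarrow> X t \<in> borel_measurable N"
    and cont: "\<And>\<omega>. \<omega> \<in> space N \<Longrightarrow> continuous_on {0..T} (\<lambda>t. X t \<omega>)"
  shows "(\<lambda>(t, \<omega>). X (max 0 (min T t)) \<omega>) \<in> borel_measurable (borel \<Otimes>\<^sub>M N)"
    and "\<omega> \<in> space N \<Longrightarrow> continuous_on A (\<lambda>t. X (max 0 (min T t)) \<omega>)"
proof -
  have clamp: "max 0 (min T t) \<in> {0..T}" for t using T by auto
  show cont': "continuous_on A (\<lambda>t. X (max 0 (min T t)) \<omega>)" if "\<omega> \<in> space N" for \<omega> A
    by (rule continuous_on_compose2[OF cont[OF that], of _ "\<lambda>t. max 0 (min T t)"])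
       (use clamp in \<open>auto intro!: continuous_intros\<close>)
  show "(\<lambda>(t, \<omega>). X (max 0 (min T t)) \<omega>) \<in> borel_measurable (borel \<Otimes>\<^sub>M N)"
    by (rule borel_measurable_continuous_process[OF meas[OF clamp] cont'])
qed

text \<open>Because \<open>u\<close> is at least 1, \<open>U\<close> increases strictly, so
  \<open>U s < Q\<close> at all times before the one where \<open>U\<close> reaches
  \<open>Q\<close>, and the integral up to that time is \<open>Q\<close>. The truncation of the
  whole integral thus becomes a condition on each time \<open>s\<close> separately, which is what an
  exchange of integrals needs.\<close>

lemma min_nn_integral_le_stopped:
  fixes u :: "real \<Rightarrow> real"
  assumes cont: "continuous_on {0..t} u" and u: "\<And>s. s \<in> {0..t} \<Longrightarrow> 1 \<le> u s" and Q: "0 < Q" and t: "0 \<le> t"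
  defines "U \<equiv> \<lambda>s. \<integral>\<^sup>+r\<in>{0..s}. ennreal (u r) \<partial>lborel"
  shows "min (U t) (ennreal Q) \<le> (\<integral>\<^sup>+s\<in>{0..t}. ennreal (u s) * indicator {s. U s < ennreal Q} s \<partial>lborel)"
proof -
  define v where "v s = integral {0..s} u" for s
  have int: "u integrable_on {a..b}" if "0 \<le> a" "b \<le> t" for a b
    using that by (intro integrable_continuous_real continuous_on_subset[OF cont]) auto
  have U: "U s = ennreal (v s)" if "s \<le> t" for s
    unfolding U_def v_def using u that
    by (intro nn_integral_has_integral_lebesgue' integrable_integral int) (force intro: order_trans[OF zero_le_one])+
  have v_less: "v s < v r" if "0 \<le> s" "s < r" "r \<le> t" for s r
  proof -
    have "v r = v s + integral {s..r} u"
      unfolding v_def using that int by (intro Henstock_Kurzweil_Integration.integral_combine[symmetric]) auto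
    moreover have "integral {s..r} (\<lambda>_. 1) \<le> integral {s..r} u"
      using that u by (intro integral_le int) auto
    ultimately show ?thesis using that by simp
  qed
  have below: "U r \<le> (\<integral>\<^sup>+s\<in>{0..t}. ennreal (u s) * indicator {s. U s < ennreal Q} s \<partial>lborel)"
    if r: "0 \<le> r" "r \<le> t" "v r \<le> Q" for r
  \<comment> \<open>At \<open>s = r\<close> the strict inequality may fail; that single time is a
    null set.\<close>
  proof (subst U_def, rule nn_integral_mono_AE, use AE_lborel_singleton[of r] in eventually_elim)
    case (elim s)
    show ?case
    proof (cases "0 \<le> s \<and> s < r")
      case True
      then have "v s < Q" using v_less[of s r] r by simp
      then have "U s < ennreal Q" using U[of s] Q True r by (simp add: ennreal_lessI)
      then show ?thesis using True r by (auto simp: indicator_def)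
    qed (use elim in \<open>auto simp: indicator_def\<close>)
  qed
  show ?thesis
  proof (cases "v t \<le> Q")
    case True
    show ?thesis by (rule order_trans[OF min.cobounded1 below]) (use t True in auto)
  next
    case False
    have "continuous_on {0..t} v"
      unfolding v_def by (intro indefinite_integral_continuous_1 int) auto
    then obtain r where r: "0 \<le> r" "r \<le> t" "v r = Q"
      using IVT'[of v 0 Q t] False t Q by (auto simp: v_def)
    then have "ennreal Q = U r" using U[of r] by simp
    also have "\<dots> \<le> (\<integral>\<^sup>+s\<in>{0..t}. ennreal (u s) * indicator {s. U s < ennreal Q} s \<partial>lborel)"
      by (rule below) (use r in auto)
    finally show ?thesis by (rule order_trans[OF min.cobounded2])
  qed
qed

text \<open>Since \<open>y\<close> is assumed to be bounded, one application of the hypothesis to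
  \<open>m = sup\<^sub>t y t * exp (- 2 b t)\<close> gives \<open>m \<le> a T + m / 2\<close>; neither continuity nor
  measurability of \<open>y\<close> is needed.\<close>

lemma gronwall_bounded:
  fixes y :: "real \<Rightarrow> real"
  assumes T: "0 \<le> T" and a: "0 \<le> a" and b: "0 < b"
    and y: "\<And>t. t \<in> {0..T} \<Longrightarrow> 0 \<le> y t" "\<And>t. t \<in> {0..T} \<Longrightarrow> y t \<le> Q"
    and le: "\<And>t. t \<in> {0..T} \<Longrightarrow> ennreal (y t) \<le> (\<integral>\<^sup>+s\<in>{0..t}. ennreal (a + b * y s) \<partial>lborel)"
    and t: "t \<in> {0..T}"
  shows "y t \<le> 2 * a * T * exp (2 * b * T)"
proof -
  define z where "z s = y s * exp (- (2 * b * s))" for s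
  define m where "m = (SUP s\<in>{0..T}. z s)"
  have z_le: "z s \<le> Q" if "s \<in> {0..T}" for s
    using mult_mono[OF y(2)[OF that] _ _ , of "exp (- (2 * b * s))" 1] y[OF that] that b
    by (auto simp: z_def)
  then have bdd: "bdd_above (z ` {0..T})" by (intro bdd_aboveI2[of _ _ Q])
  have zm: "z s \<le> m" if "s \<in> {0..T}" for s
    unfolding m_def using bdd that by (rule cSUP_upper[rotated])
  have m0: "0 \<le> m" using zm[of t] y(1)[OF t] t by (auto simp: z_def intro: order_trans[rotated])
  have ym: "y s \<le> m * exp (2 * b * s)" if "s \<in> {0..T}" for s
    using zm[OF that] by (simp add: z_def exp_minus field_simps)
  have step: "z s \<le> a * T + m / 2" if s: "s \<in> {0..T}" for s
  proof -
    have "ennreal (y s) \<le> (\<integral>\<^sup>+r\<in>{0..s}. ennreal (a + b * m * exp (2 * b * r)) \<partial>lborel)"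
      by (rule order_trans[OF le[OF s]], rule nn_integral_mono)
         (use ym s b in \<open>auto simp: indicator_def mult.assoc intro!: ennreal_leI mult_left_mono\<close>)
    also have "\<dots> = ennreal ((a * s + m / 2 * exp (2 * b * s)) - (a * 0 + m / 2 * exp (2 * b * 0)))"
      by (rule nn_integral_FTC_Icc)
         (use a b m0 s in \<open>auto intro!: derivative_eq_intros add_nonneg_nonneg mult_nonneg_nonneg\<close>)
    also have "\<dots> \<le> ennreal (a * T + m / 2 * exp (2 * b * s))"
      using s a m0 by (intro ennreal_leI) (auto intro: mult_left_mono order_trans[of _ "a * s"])
    finally have "y s \<le> a * T + m / 2 * exp (2 * b * s)"
      using a T m0 by (subst (asm) ennreal_le_iff) auto
    then have "z s \<le> (a * T + m / 2 * exp (2 * b * s)) * exp (- (2 * b * s))"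
      unfolding z_def by (rule mult_right_mono) simp
    also have "\<dots> = a * T * exp (- (2 * b * s)) + m / 2"
      by (simp add: algebra_simps flip: exp_add)
    also have "\<dots> \<le> a * T + m / 2"
      using a T b s by (simp add: mult_left_le)
    finally show ?thesis .
  qed
  have "m \<le> a * T + m / 2"
    unfolding m_def by (rule cSUP_least) (use T step in \<open>auto simp: m_def\<close>)
  then have m: "m \<le> 2 * a * T" by simp
  have "y t \<le> m * exp (2 * b * t)" by (rule ym[OF t])
  also have "\<dots> \<le> 2 * a * T * exp (2 * b * T)"
    using m a T b t by (intro mult_mono) auto
  finally show ?thesis .
qed

text \<open>As \<open>U\<close> is finite, the truncation events increase to the whole space, and
  monotone convergence removes the truncation.\<close>

lemma nn_integral_le_of_truncations:
  fixes U G :: "'a \<Rightarrow> ennreal"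
  assumes [measurable]: "U \<in> borel_measurable M" "G \<in> borel_measurable M"
    and fin: "\<And>\<omega>. \<omega> \<in> space M \<Longrightarrow> U \<omega> < \<infinity>"
    and le: "\<And>n::nat. 0 < n \<Longrightarrow> (\<integral>\<^sup>+\<omega>. G \<omega> * indicator {\<omega>. U \<omega> < of_nat n} \<omega> \<partial>M) \<le> B"
  shows "(\<integral>\<^sup>+\<omega>. G \<omega> \<partial>M) \<le> B"
proof -
  have "(\<integral>\<^sup>+\<omega>. G \<omega> \<partial>M) = (\<integral>\<^sup>+\<omega>. (SUP n. G \<omega> * indicator {\<omega>. U \<omega> < of_nat (Suc n)} \<omega>) \<partial>M)"
  proof (rule nn_integral_cong, rule antisym)
    fix \<omega> assume "\<omega> \<in> space M"
    then obtain n :: nat where "U \<omega> < of_nat n"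
      using fin[of \<omega>] by (metis ennreal_Ex_less_of_nat infinity_ennreal_def)
    then have "U \<omega> < of_nat (Suc n)"
      by (rule less_le_trans) (simp add: add_increasing)
    then have "G \<omega> = G \<omega> * indicator {\<omega>. U \<omega> < of_nat (Suc n)} \<omega>" by simp
    also have "\<dots> \<le> (SUP n. G \<omega> * indicator {\<omega>. U \<omega> < of_nat (Suc n)} \<omega>)"
      by (rule SUP_upper) simp
    finally show "G \<omega> \<le> (SUP n. G \<omega> * indicator {\<omega>. U \<omega> < of_nat (Suc n)} \<omega>)" .
  qed (auto intro!: SUP_least simp: indicator_def)
  also have "\<dots> = (SUP n. \<integral>\<^sup>+\<omega>. G \<omega> * indicator {\<omega>. U \<omega> < of_nat (Suc n)} \<omega> \<partial>M)"
  proof (rule nn_integral_monotone_convergence_SUP)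
    have "U \<omega> < of_nat (Suc m) \<Longrightarrow> m \<le> n \<Longrightarrow> U \<omega> < of_nat (Suc n)" for \<omega> m n
      by (erule less_le_trans) (simp add: add_mono)
    then show "incseq (\<lambda>n \<omega>. G \<omega> * indicator {\<omega>. U \<omega> < of_nat (Suc n)} \<omega>)"
      by (auto simp: incseq_def le_fun_def indicator_def)
  qed measurable
  also have "\<dots> \<le> B"
    by (rule SUP_least) (rule le, simp)
  finally show ?thesis .
qed

text \<open>The first conclusion serves the running costs, the second the terminal costs. The free
  factor \<open>D\<close> lets a growth constant of the cost be inserted directly.\<close>

lemma (in brownian) sde_solution_second_moment:
  fixes X :: "real \<Rightarrow> 'w \<Rightarrow> real^'d"
  assumes T: "0 \<le> T" and sol: "sde_solution M W T \<mu> \<sigma> \<xi> X"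
    and \<mu>: "\<And>t x. t \<in> {0..T} \<Longrightarrow> norm (\<mu> t x) \<le> C * (1 + norm x)"
    and \<sigma>: "\<And>t x. t \<in> {0..T} \<Longrightarrow> norm (\<sigma> t x) \<le> C * (1 + norm x)"
  shows "(\<integral>\<^sup>+\<omega>. (\<integral>\<^sup>+s\<in>{0..T}. ennreal (D * (1 + (norm (X s \<omega>))\<^sup>2)) \<partial>lborel) \<partial>M) < \<infinity>"
    and "t \<in> {0..T} \<Longrightarrow> (\<integral>\<^sup>+\<omega>. ennreal ((norm (X t \<omega>))\<^sup>2) \<partial>M) < \<infinity>"
proof -
  \<comment> \<open>Raising the growth constant to at least 1 gives \<open>1 \<le> u\<close>, hence
    a strictly increasing \<open>U\<close>. The factor 2 in \<open>u\<close> ensures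
    \<open>2 * V \<le> U\<close>, so the event \<open>U s < Q\<close> lies within the event on which
    the Ito integral is controlled.\<close>
  define c where "c = max C 1"
  define Y where "Y s = X (max 0 (min T s))" for s
  define u where "u s \<omega> = 2 * (c * (1 + norm (Y s \<omega>)))\<^sup>2" for s \<omega>
  define U where "U s \<omega> = (\<integral>\<^sup>+r\<in>{0..s}. ennreal (u r \<omega>) \<partial>lborel)" for s \<omega>
  have c: "1 \<le> c" "C \<le> c" by (auto simp: c_def)
  have clamp: "max 0 (min T s) \<in> {0..T}" for s using T by auto
  have YX: "Y s = X s" if "s \<in> {0..T}" for s
    using that by (simp add: Y_def)
  obtain I where ito: "has_ito_integral M \<F> W T (\<lambda>t \<omega>. \<sigma> t (X t \<omega>)) I"
    and X_eq: "\<And>s. s \<in> {0..T} \<Longrightarrow> AE \<omega> in M. X s \<omega> = \<xi> + (LINT r:{0..s}|lborel. \<mu> r (X r \<omega>)) + I s \<omega>"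
    using sol by (auto simp: sde_solution_def)
  have Y_meas0: "Y s \<in> borel_measurable M" for s
    unfolding Y_def using sol clamp[of s]
    by (intro measurable_filtration_imp[of _ "max 0 (min T s)"]) (auto simp: sde_solution_def)
  have X_cont: "continuous_on {0..T} (\<lambda>s. X s \<omega>)" if "\<omega> \<in> space M" for \<omega>
    using sol that by (auto simp: sde_solution_def)
  have X_meas: "X s \<in> borel_measurable M" if "s \<in> {0..T}" for s
    using Y_meas0[of s] YX[OF that] by simp
  have Y_cont: "continuous_on A (\<lambda>s. Y s \<omega>)" if "\<omega> \<in> space M" for A \<omega>
    unfolding Y_def by (rule borel_measurable_continuous_process_Icc(2)[OF T X_meas X_cont that])
  have Y_meas [measurable]: "(\<lambda>(s, \<omega>). Y s \<omega>) \<in> borel_measurable (borel \<Otimes>\<^sub>M M)"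
    unfolding Y_def by (rule borel_measurable_continuous_process_Icc(1)[OF T X_meas X_cont])
  note [measurable] = Y_meas0
  have u_meas [measurable]: "(\<lambda>(s, \<omega>). u s \<omega>) \<in> borel_measurable (borel \<Otimes>\<^sub>M M)"
    unfolding u_def by measurable
  have u_cont: "continuous_on A (\<lambda>s. u s \<omega>)" if "\<omega> \<in> space M" for A \<omega>
    unfolding u_def by (intro continuous_intros Y_cont that)
  have u1: "1 \<le> u s \<omega>" for s \<omega>
  proof -
    have "1 * 1 \<le> c * (1 + norm (Y s \<omega>))" using c by (intro mult_mono) auto
    then have "1 \<le> (c * (1 + norm (Y s \<omega>)))\<^sup>2" by (simp add: one_le_power)
    then show ?thesis by (simp add: u_def)
  qed
  have U_meas [measurable]: "(\<lambda>(s, \<omega>). U s \<omega>) \<in> borel_measurable (borel \<Otimes>\<^sub>M M)"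
    unfolding U_def by (measurable, unfold atLeastAtMost_iff, measurable)
  have U_meas0 [measurable]: "U s \<in> borel_measurable M" for s
    unfolding U_def by measurable
  have U_fin: "U s \<omega> < \<infinity>" if \<omega>: "\<omega> \<in> space M" for s \<omega>
  proof -
    have "(\<integral>\<^sup>+r. ennreal (u r \<omega>) * indicator {0..s} r \<partial>lborel) = ennreal (integral {0..s} (\<lambda>r. u r \<omega>))"
      by (intro nn_integral_has_integral_lebesgue' integrable_integral integrable_continuous_real u_cont \<omega>)
         (auto intro: order_trans[OF zero_le_one u1])
    then show ?thesis by (simp add: U_def)
  qed
  define y where "y Q s = (\<integral>\<^sup>+\<omega>. min (U s \<omega>) (ennreal Q) \<partial>M)" for Q s
  have y_le: "y Q s \<le> ennreal Q" for Q s
  proof -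
    have "y Q s \<le> (\<integral>\<^sup>+\<omega>. ennreal Q \<partial>M)" unfolding y_def by (intro nn_integral_mono) auto
    then show ?thesis by (simp add: emeasure_space_1)
  qed
  \<comment> \<open>The factor 3 is from squaring a sum of three terms. Then \<open>3 * T\<close>
    belongs to the drift, through Cauchy-Schwarz, and 6 is 3 times the factor 2 of the Ito
    estimate.\<close>
  have moment: "(\<integral>\<^sup>+\<omega>. ennreal ((norm (X s \<omega>))\<^sup>2) * indicator {\<omega>. U s \<omega> < ennreal Q} \<omega> \<partial>M) \<le>
      ennreal (3 * (norm \<xi>)\<^sup>2) + ennreal (3 * T + 6) * y Q s" if s: "s \<in> {0..T}" and Q: "0 < Q" for s Q
  proof -
    define V where "V \<omega> = (\<integral>\<^sup>+r\<in>{0..s}. ennreal ((norm (\<sigma> r (X r \<omega>)))\<^sup>2) \<partial>lborel)" for \<omega>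
    define b where "b \<omega> = (LINT r:{0..s}|lborel. \<mu> r (X r \<omega>))" for \<omega>
    have [measurable]: "I s \<in> borel_measurable M" using ito s by (auto simp: has_ito_integral_def)
    have VU: "2 * V \<omega> \<le> U s \<omega>" if \<omega>: "\<omega> \<in> space M" for \<omega>
    proof -
      have [measurable]: "(\<lambda>r. Y r \<omega>) \<in> borel_measurable borel"
        using Y_cont[OF \<omega>] by (rule borel_measurable_continuous_onI)
      have "V \<omega> \<le> (\<integral>\<^sup>+r\<in>{0..s}. ennreal ((c * (1 + norm (Y r \<omega>)))\<^sup>2) \<partial>lborel)"
        unfolding V_def
      proof (rule nn_integral_mono)
        fix r :: real
        show "ennreal ((norm (\<sigma> r (X r \<omega>)))\<^sup>2) * indicator {0..s} r \<le>
          ennreal ((c * (1 + norm (Y r \<omega>)))\<^sup>2) * indicator {0..s} r"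
        proof (cases "r \<in> {0..s}")
          case True
          then have r: "r \<in> {0..T}" using s by auto
          have "norm (\<sigma> r (X r \<omega>)) \<le> c * (1 + norm (Y r \<omega>))"
            using \<sigma>[OF r, of "X r \<omega>"] mult_right_mono[OF c(2), of "1 + norm (X r \<omega>)"] YX[OF r] by simp
          then show ?thesis using True by (auto intro!: ennreal_leI power_mono)
        qed simp
      qed
      then have "2 * V \<omega> \<le> 2 * (\<integral>\<^sup>+r\<in>{0..s}. ennreal ((c * (1 + norm (Y r \<omega>)))\<^sup>2) \<partial>lborel)"
        by (rule mult_left_mono) simp
      also have "\<dots> = U s \<omega>"
        unfolding U_def u_def
        by (subst nn_integral_cmult[symmetric]) (auto simp: ennreal_mult' mult.assoc)
      finally show ?thesis .
    qed
    have bU: "ennreal ((norm (b \<omega>))\<^sup>2) \<le> ennreal T * U s \<omega>" if \<omega>: "\<omega> \<in> space M" for \<omega>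
    proof -
      have [measurable]: "(\<lambda>r. Y r \<omega>) \<in> borel_measurable borel"
        using Y_cont[OF \<omega>] by (rule borel_measurable_continuous_onI)
      let ?w = "\<lambda>r. ennreal (c * (1 + norm (Y r \<omega>))) * indicator {0..s} r"
      \<comment> \<open>A Bochner integral of a non-integrable function is 0 by convention, so the
        bound holds in either case.\<close>
      have "ennreal (norm (b \<omega>)) \<le> (\<integral>\<^sup>+r. norm (indicator {0..s} r *\<^sub>R \<mu> r (X r \<omega>)) \<partial>lborel)"
        unfolding b_def set_lebesgue_integral_def
        by (cases "integrable lborel (\<lambda>r. indicator {0..s} r *\<^sub>R \<mu> r (X r \<omega>))")
           (auto intro: integral_norm_bound_ennreal[THEN order_trans] simp: not_integrable_integral_eq)
      \<comment> \<open>The repeated indicator is the second factor for Cauchy-Schwarz; its squared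
        integral is the length \<open>s\<close>, at most \<open>T\<close>.\<close>
      also have "\<dots> \<le> (\<integral>\<^sup>+r. ?w r * indicator {0..s} r \<partial>lborel)"
      proof (rule nn_integral_mono)
        fix r :: real
        show "ennreal (norm (indicator {0..s} r *\<^sub>R \<mu> r (X r \<omega>))) \<le> ?w r * indicator {0..s} r"
        proof (cases "r \<in> {0..s}")
          case True
          then have r: "r \<in> {0..T}" using s by auto
          have "norm (\<mu> r (X r \<omega>)) \<le> c * (1 + norm (Y r \<omega>))"
            using \<mu>[OF r, of "X r \<omega>"] mult_right_mono[OF c(2), of "1 + norm (X r \<omega>)"] YX[OF r] by simp
          then show ?thesis using True by (auto intro!: ennreal_leI)
        qed simp
      qed
      finally have "(ennreal (norm (b \<omega>)))\<^sup>2 \<le> (\<integral>\<^sup>+r. ?w r * indicator {0..s} r \<partial>lborel)\<^sup>2"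
        by (rule power_mono) simp
      also have "\<dots> \<le> (\<integral>\<^sup>+r. (?w r)\<^sup>2 \<partial>lborel) * (\<integral>\<^sup>+r. (indicator {0..s} r)\<^sup>2 \<partial>lborel)"
        by (rule Cauchy_Schwarz_nn_integral) measurable
      also have "\<dots> \<le> U s \<omega> * ennreal T"
      proof (rule mult_mono)
        have "(?w r)\<^sup>2 \<le> ennreal (u r \<omega>) * indicator {0..s} r" for r
          using c by (auto simp: u_def indicator_def ennreal_power intro!: ennreal_leI)
        then show "(\<integral>\<^sup>+r. (?w r)\<^sup>2 \<partial>lborel) \<le> U s \<omega>"
          unfolding U_def by (intro nn_integral_mono)
        have "(\<integral>\<^sup>+r. (indicator {0..s} r)\<^sup>2 \<partial>lborel) = (\<integral>\<^sup>+r. indicator {0..s} r \<partial>lborel)"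
          by (intro nn_integral_cong) (auto simp: indicator_def)
        then show "(\<integral>\<^sup>+r. (indicator {0..s} r)\<^sup>2 \<partial>lborel) \<le> ennreal T"
          using s by (auto intro!: ennreal_leI)
      qed auto
      finally show ?thesis by (simp add: ennreal_power mult.commute)
    qed
    have "(\<integral>\<^sup>+\<omega>. ennreal ((norm (X s \<omega>))\<^sup>2) * indicator {\<omega>. U s \<omega> < ennreal Q} \<omega> \<partial>M) \<le>
      (\<integral>\<^sup>+\<omega>. ennreal (3 * (norm \<xi>)\<^sup>2) + (ennreal (3 * T) * min (U s \<omega>) (ennreal Q) +
        3 * (ennreal ((norm (I s \<omega>))\<^sup>2) * indicator {\<omega>. 2 * V \<omega> < ennreal Q} \<omega>)) \<partial>M)"
    proof (intro nn_integral_mono_AE, use X_eq[OF s] AE_space in eventually_elim)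
      case (elim \<omega>)
      show ?case
      \<comment> \<open>On this event \<open>min (U s \<omega>) (ennreal Q)\<close> is
        \<open>U s \<omega>\<close> itself, so the drift bound survives truncation; off it the
        left-hand side is zero.\<close>
      proof (cases "U s \<omega> < ennreal Q")
        case True
        have "norm (X s \<omega>) \<le> norm \<xi> + norm (b \<omega>) + norm (I s \<omega>)"
          unfolding elim(1) b_def[symmetric] by norm
        then have "(norm (X s \<omega>))\<^sup>2 \<le> (norm \<xi> + norm (b \<omega>) + norm (I s \<omega>))\<^sup>2"
          by (rule power_mono) simp
        also have "\<dots> \<le> 3 * (norm \<xi>)\<^sup>2 + (3 * (norm (b \<omega>))\<^sup>2 + 3 * (norm (I s \<omega>))\<^sup>2)"
          using sum_squares_bound[of "norm \<xi>" "norm (b \<omega>)"] sum_squares_bound[of "norm \<xi>" "norm (I s \<omega>)"]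
            sum_squares_bound[of "norm (b \<omega>)" "norm (I s \<omega>)"]
          by (simp add: power2_eq_square algebra_simps)
        finally have "ennreal ((norm (X s \<omega>))\<^sup>2) \<le>
          ennreal (3 * (norm \<xi>)\<^sup>2) + (3 * ennreal ((norm (b \<omega>))\<^sup>2) + 3 * ennreal ((norm (I s \<omega>))\<^sup>2))"
          by (subst (asm) ennreal_le_iff[symmetric]) (auto simp: ennreal_mult')
        also have "\<dots> \<le> ennreal (3 * (norm \<xi>)\<^sup>2) + (3 * (ennreal T * U s \<omega>) + 3 * ennreal ((norm (I s \<omega>))\<^sup>2))"
          by (intro add_mono mult_left_mono bU elim) auto
        finally show ?thesis
          using True VU[OF elim(2)] T by (auto simp: min_def indicator_def ennreal_mult' mult.assoc)
      qed simp
    qed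
    also have "\<dots> = ennreal (3 * (norm \<xi>)\<^sup>2) + (ennreal (3 * T) * y Q s +
        3 * (\<integral>\<^sup>+\<omega>. ennreal ((norm (I s \<omega>))\<^sup>2) * indicator {\<omega>. 2 * V \<omega> < ennreal Q} \<omega> \<partial>M))"
    proof -
      have [measurable]: "V \<in> borel_measurable M"
        unfolding V_def
      proof (rule borel_measurable_set_nn_integral_Icc[of _ T])
        have [measurable]: "(\<lambda>(r, \<omega>). \<sigma> r (X r \<omega>)) \<in> borel_measurable (restrict_space borel {0..T} \<Otimes>\<^sub>M M)"
          using ito T by (intro progressively_measurable_imp_borel_measurable) (auto simp: has_ito_integral_def)
        show "(\<lambda>(r, \<omega>). ennreal ((norm (\<sigma> r (X r \<omega>)))\<^sup>2)) \<in> borel_measurable (restrict_space borel {0..T} \<Otimes>\<^sub>M M)"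
          by measurable
      qed (use s in simp)
      show ?thesis
        by (simp add: nn_integral_add nn_integral_cmult y_def emeasure_space_1)
    qed
    also have "\<dots> \<le> ennreal (3 * (norm \<xi>)\<^sup>2) + (ennreal (3 * T) * y Q s + 3 * (2 * y Q s))"
    proof (intro add_mono mult_left_mono order_refl)
      have "(\<integral>\<^sup>+\<omega>. ennreal ((norm (I s \<omega>))\<^sup>2) * indicator {\<omega>. 2 * V \<omega> < ennreal Q} \<omega> \<partial>M) \<le>
         2 * (\<integral>\<^sup>+\<omega>. min (V \<omega>) (ennreal Q) \<partial>M)"
        unfolding V_def by (rule ito_integral_truncated_moment[OF ito s Q])
      also have "\<dots> \<le> 2 * y Q s"
        unfolding y_def
      proof (intro mult_left_mono nn_integral_mono min.mono order_refl)
        fix \<omega> assume "\<omega> \<in> space M"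
        have "V \<omega> \<le> 2 * V \<omega>" by (simp add: mult_2)
        then show "V \<omega> \<le> U s \<omega>" using VU[OF \<open>\<omega> \<in> space M\<close>] by (rule order_trans)
      qed simp
      finally show "(\<integral>\<^sup>+\<omega>. ennreal ((norm (I s \<omega>))\<^sup>2) * indicator {\<omega>. 2 * V \<omega> < ennreal Q} \<omega> \<partial>M) \<le> 2 * y Q s" .
    qed auto
    also have "\<dots> = ennreal (3 * (norm \<xi>)\<^sup>2) + ennreal (3 * T + 6) * y Q s"
      using T by (simp add: distrib_right ennreal_plus mult.assoc[symmetric])
    finally show ?thesis .
  qed
  \<comment> \<open>The factor \<open>4 * c\<^sup>2\<close> is from bounding \<open>u\<close> by
    \<open>4 * c\<^sup>2 * (1 + (norm (Y s \<omega>))\<^sup>2)\<close>; the remaining constants are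
    those of \<open>moment\<close>.\<close>
  define a where "a = 4 * c\<^sup>2 * (1 + 3 * (norm \<xi>)\<^sup>2)"
  define \<beta> where "\<beta> = 4 * c\<^sup>2 * (3 * T + 6)"
  have a0: "0 \<le> a" and \<beta>0: "0 < \<beta>" using c T by (auto simp: a_def \<beta>_def)
  have u_le: "u s \<omega> \<le> 4 * c\<^sup>2 + 4 * c\<^sup>2 * (norm (Y s \<omega>))\<^sup>2" for s \<omega>
  proof -
    have "(1 + norm (Y s \<omega>))\<^sup>2 \<le> 2 * (1 + (norm (Y s \<omega>))\<^sup>2)"
      using sum_squares_bound[of 1 "norm (Y s \<omega>)"] by (simp add: power2_sum)
    then have "2 * c\<^sup>2 * (1 + norm (Y s \<omega>))\<^sup>2 \<le> 2 * c\<^sup>2 * (2 * (1 + (norm (Y s \<omega>))\<^sup>2))"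
      by (rule mult_left_mono) simp
    then show ?thesis unfolding u_def power_mult_distrib by (simp add: algebra_simps)
  qed
  have u_moment: "(\<integral>\<^sup>+\<omega>. ennreal (u s \<omega>) * indicator {\<omega>. U s \<omega> < ennreal Q} \<omega> \<partial>M) \<le> ennreal a + ennreal \<beta> * y Q s"
    if s: "s \<in> {0..T}" and Q: "0 < Q" for s Q
  proof -
    have "(\<integral>\<^sup>+\<omega>. ennreal (u s \<omega>) * indicator {\<omega>. U s \<omega> < ennreal Q} \<omega> \<partial>M) \<le>
      (\<integral>\<^sup>+\<omega>. ennreal (4 * c\<^sup>2) + ennreal (4 * c\<^sup>2) * (ennreal ((norm (X s \<omega>))\<^sup>2) * indicator {\<omega>. U s \<omega> < ennreal Q} \<omega>) \<partial>M)"
    proof (rule nn_integral_mono)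
      fix \<omega>
      have "ennreal (u s \<omega>) \<le> ennreal (4 * c\<^sup>2 + 4 * c\<^sup>2 * (norm (X s \<omega>))\<^sup>2)"
        using u_le[of s \<omega>] YX[OF s] by (intro ennreal_leI) simp
      also have "\<dots> = ennreal (4 * c\<^sup>2) + ennreal (4 * c\<^sup>2) * ennreal ((norm (X s \<omega>))\<^sup>2)"
        by (simp add: ennreal_mult'')
      finally show "ennreal (u s \<omega>) * indicator {\<omega>. U s \<omega> < ennreal Q} \<omega> \<le>
        ennreal (4 * c\<^sup>2) + ennreal (4 * c\<^sup>2) * (ennreal ((norm (X s \<omega>))\<^sup>2) * indicator {\<omega>. U s \<omega> < ennreal Q} \<omega>)"
        by (auto simp: indicator_def)
    qed
    also have "\<dots> = ennreal (4 * c\<^sup>2) + ennreal (4 * c\<^sup>2) *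
        (\<integral>\<^sup>+\<omega>. ennreal ((norm (X s \<omega>))\<^sup>2) * indicator {\<omega>. U s \<omega> < ennreal Q} \<omega> \<partial>M)"
      unfolding YX[OF s, symmetric] by (simp add: nn_integral_add nn_integral_cmult emeasure_space_1)
    also have "\<dots> \<le> ennreal (4 * c\<^sup>2) + ennreal (4 * c\<^sup>2) * (ennreal (3 * (norm \<xi>)\<^sup>2) + ennreal (3 * T + 6) * y Q s)"
      by (intro add_mono mult_left_mono moment s Q) auto
    also have "\<dots> = ennreal a + ennreal \<beta> * y Q s"
    proof -
      have "a = 4 * c\<^sup>2 + 4 * c\<^sup>2 * (3 * (norm \<xi>)\<^sup>2)" by (simp add: a_def distrib_left)
      then have "ennreal a = ennreal (4 * c\<^sup>2) + ennreal (4 * c\<^sup>2) * ennreal (3 * (norm \<xi>)\<^sup>2)"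
        by (simp only: ennreal_plus ennreal_mult zero_le_power2 zero_le_numeral mult_nonneg_nonneg)
      moreover have "ennreal \<beta> = ennreal (4 * c\<^sup>2) * ennreal (3 * T + 6)"
        unfolding \<beta>_def using T by (intro ennreal_mult) auto
      ultimately show ?thesis by (simp only: distrib_left add.assoc mult.assoc)
    qed
    finally show ?thesis .
  qed
  \<comment> \<open>The event attached to the integrand concerns the same time \<open>s\<close> as
    the integrand, so after Tonelli \<open>u_moment\<close> applies to each \<open>s\<close>
    separately.\<close>
  have y_step: "y Q t \<le> (\<integral>\<^sup>+s\<in>{0..t}. ennreal a + ennreal \<beta> * y Q s \<partial>lborel)"
    if t: "t \<in> {0..T}" and Q: "0 < Q" for t Q
  proof -
    have "y Q t \<le> (\<integral>\<^sup>+\<omega>. (\<integral>\<^sup>+s\<in>{0..t}. ennreal (u s \<omega>) * indicator {s. U s \<omega> < ennreal Q} s \<partial>lborel) \<partial>M)"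
      unfolding y_def U_def
      by (intro nn_integral_mono min_nn_integral_le_stopped u_cont u1 Q) (use t in auto)
    also have "\<dots> = (\<integral>\<^sup>+\<omega>. (\<integral>\<^sup>+s. ennreal (u s \<omega>) * indicator {\<omega>. U s \<omega> < ennreal Q} \<omega> * indicator {0..t} s \<partial>lborel) \<partial>M)"
      by (simp add: indicator_def)
    also have "\<dots> = (\<integral>\<^sup>+s. (\<integral>\<^sup>+\<omega>. ennreal (u s \<omega>) * indicator {\<omega>. U s \<omega> < ennreal Q} \<omega> * indicator {0..t} s \<partial>M) \<partial>lborel)"
    proof -
      interpret pair_sigma_finite lborel M ..
      show ?thesis by (rule Fubini') measurable
    qed
    also have "\<dots> \<le> (\<integral>\<^sup>+s\<in>{0..t}. ennreal a + ennreal \<beta> * y Q s \<partial>lborel)"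
    proof (rule nn_integral_mono)
      fix s :: real
      show "(\<integral>\<^sup>+\<omega>. ennreal (u s \<omega>) * indicator {\<omega>. U s \<omega> < ennreal Q} \<omega> * indicator {0..t} s \<partial>M)
        \<le> (ennreal a + ennreal \<beta> * y Q s) * indicator {0..t} s"
        using u_moment[of s, OF _ Q] t by (cases "s \<in> {0..t}") auto
    qed
    finally show ?thesis .
  qed
  define L where "L = 2 * a * T * exp (2 * \<beta> * T)"
  have y_bound: "y Q t \<le> ennreal L" if t: "t \<in> {0..T}" and Q: "0 < Q" for t Q
  proof -
    \<comment> \<open>The truncated expectation is at most \<open>Q\<close>, hence a real number,
      and this is the boundedness that the Gronwall argument presupposes.\<close>
    have yr: "y Q s = ennreal (enn2real (y Q s))" for s
      using y_le[of Q s] by (metis ennreal_enn2real ennreal_less_top le_less_trans)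
    have "enn2real (y Q t) \<le> L"
      unfolding L_def
    proof (rule gronwall_bounded[OF T a0 \<beta>0 _ _ _ t])
      fix s assume s: "s \<in> {0..T}"
      show "enn2real (y Q s) \<le> Q" using y_le[of Q s] Q by (simp add: enn2real_leI)
      have "ennreal (a + \<beta> * enn2real (y Q r)) = ennreal a + ennreal \<beta> * y Q r" for r
        using a0 \<beta>0 by (subst (2) yr) (simp add: ennreal_mult')
      then show "ennreal (enn2real (y Q s)) \<le> (\<integral>\<^sup>+r\<in>{0..s}. ennreal (a + \<beta> * enn2real (y Q r)) \<partial>lborel)"
        using y_step[OF s Q] by (simp add: yr[symmetric])
    qed simp
    then show ?thesis by (subst yr) (rule ennreal_leI)
  qed
  have "(\<integral>\<^sup>+\<omega>. U T \<omega> \<partial>M) \<le> ennreal L"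
  proof (rule nn_integral_le_of_truncations[where U="U T"])
    fix n :: nat assume n: "0 < n"
    have "(\<integral>\<^sup>+\<omega>. U T \<omega> * indicator {\<omega>. U T \<omega> < of_nat n} \<omega> \<partial>M) \<le> y (real n) T"
      unfolding y_def by (intro nn_integral_mono) (auto simp: indicator_def ennreal_of_nat_eq_real_of_nat)
    also have "\<dots> \<le> ennreal L" by (rule y_bound) (use T n in auto)
    finally show "(\<integral>\<^sup>+\<omega>. U T \<omega> * indicator {\<omega>. U T \<omega> < of_nat n} \<omega> \<partial>M) \<le> ennreal L" .
  qed (use U_fin in auto)
  moreover have "(\<integral>\<^sup>+\<omega>. (\<integral>\<^sup>+s\<in>{0..T}. ennreal (D * (1 + (norm (X s \<omega>))\<^sup>2)) \<partial>lborel) \<partial>M) \<le>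
      (\<integral>\<^sup>+\<omega>. ennreal \<bar>D\<bar> * U T \<omega> \<partial>M)"
  proof (intro nn_integral_mono)
    fix \<omega> assume \<omega>: "\<omega> \<in> space M"
    have [measurable]: "(\<lambda>r. Y r \<omega>) \<in> borel_measurable borel"
      using Y_cont[OF \<omega>] by (rule borel_measurable_continuous_onI)
    have "(\<integral>\<^sup>+s\<in>{0..T}. ennreal (D * (1 + (norm (X s \<omega>))\<^sup>2)) \<partial>lborel) \<le>
      (\<integral>\<^sup>+s. ennreal \<bar>D\<bar> * (ennreal (u s \<omega>) * indicator {0..T} s) \<partial>lborel)"
    proof (intro nn_integral_mono)
      fix s :: real
      show "ennreal (D * (1 + (norm (X s \<omega>))\<^sup>2)) * indicator {0..T} s \<le> ennreal \<bar>D\<bar> * (ennreal (u s \<omega>) * indicator {0..T} s)"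
      proof (cases "s \<in> {0..T}")
        case True
        have "1 + (norm (Y s \<omega>))\<^sup>2 \<le> (1 + norm (Y s \<omega>))\<^sup>2" by (simp add: power2_sum)
        also have "\<dots> \<le> (c * (1 + norm (Y s \<omega>)))\<^sup>2"
          using c mult_right_mono[of 1 c "1 + norm (Y s \<omega>)"] by (intro power_mono) auto
        also have "\<dots> \<le> u s \<omega>"
          using zero_le_power2[of "c * (1 + norm (Y s \<omega>))"] unfolding u_def by linarith
        finally have "D * (1 + (norm (X s \<omega>))\<^sup>2) \<le> \<bar>D\<bar> * u s \<omega>"
          using YX[OF True] by (intro mult_mono) auto
        then show ?thesis
          using True by (auto simp: ennreal_mult'[symmetric] intro: ennreal_leI)
      qed simp
    qed
    also have "\<dots> = ennreal \<bar>D\<bar> * U T \<omega>"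
      unfolding U_def u_def by (rule nn_integral_cmult) measurable
    finally show "(\<integral>\<^sup>+s\<in>{0..T}. ennreal (D * (1 + (norm (X s \<omega>))\<^sup>2)) \<partial>lborel) \<le> ennreal \<bar>D\<bar> * U T \<omega>" .
  qed
  moreover have "(\<integral>\<^sup>+\<omega>. ennreal \<bar>D\<bar> * U T \<omega> \<partial>M) = ennreal \<bar>D\<bar> * (\<integral>\<^sup>+\<omega>. U T \<omega> \<partial>M)"
    by (rule nn_integral_cmult) measurable
  ultimately show "(\<integral>\<^sup>+\<omega>. (\<integral>\<^sup>+s\<in>{0..T}. ennreal (D * (1 + (norm (X s \<omega>))\<^sup>2)) \<partial>lborel) \<partial>M) < \<infinity>"
    using ennreal_mult_less_top[of "ennreal \<bar>D\<bar>" "\<integral>\<^sup>+\<omega>. U T \<omega> \<partial>M"] le_less_trans[OF _ ennreal_less_top[of L]]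
    by (auto intro: le_less_trans)
  assume t: "t \<in> {0..T}"
  have "(\<integral>\<^sup>+\<omega>. ennreal ((norm (X t \<omega>))\<^sup>2) \<partial>M) \<le> ennreal (3 * (norm \<xi>)\<^sup>2) + ennreal (3 * T + 6) * ennreal L"
  proof (rule nn_integral_le_of_truncations[where U="U t"])
    fix n :: nat assume n: "0 < n"
    have "(\<integral>\<^sup>+\<omega>. ennreal ((norm (X t \<omega>))\<^sup>2) * indicator {\<omega>. U t \<omega> < of_nat n} \<omega> \<partial>M) \<le>
      ennreal (3 * (norm \<xi>)\<^sup>2) + ennreal (3 * T + 6) * y (real n) t"
      using moment[OF t, of "real n"] n by (simp add: ennreal_of_nat_eq_real_of_nat)
    also have "\<dots> \<le> ennreal (3 * (norm \<xi>)\<^sup>2) + ennreal (3 * T + 6) * ennreal L"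
      by (intro add_mono mult_left_mono y_bound t) (use n in auto)
    finally show "(\<integral>\<^sup>+\<omega>. ennreal ((norm (X t \<omega>))\<^sup>2) * indicator {\<omega>. U t \<omega> < of_nat n} \<omega> \<partial>M) \<le>
      ennreal (3 * (norm \<xi>)\<^sup>2) + ennreal (3 * T + 6) * ennreal L" .
  qed (use U_fin Y_meas0[of t] YX[OF t] in auto)
  also have "\<dots> < \<infinity>" by (simp add: ennreal_mult_less_top)
  finally show "(\<integral>\<^sup>+\<omega>. ennreal ((norm (X t \<omega>))\<^sup>2) \<partial>M) < \<infinity>" .
qed

subsection \<open>The potential of the game\<close>

lemma integral_add_weighted_sum:
  fixes F :: "'a \<Rightarrow> real"
  assumes "integrable M F" "\<And>j. j \<in> I \<Longrightarrow> integrable M (G j)"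
  shows "(LINT x|M. F x + (\<Sum>j\<in>I. c j * G j x)) = (LINT x|M. F x) + (\<Sum>j\<in>I. c j * (LINT x|M. G j x))"
  using assms by (simp add: Bochner_Integration.integral_add Bochner_Integration.integrable_sum Bochner_Integration.integral_sum)

lemma set_integral_add_weighted_sum:
  fixes F :: "'a \<Rightarrow> real"
  assumes "set_integrable M A F" "\<And>j. j \<in> I \<Longrightarrow> set_integrable M A (G j)"
  shows "(LINT x:A|M. F x + (\<Sum>j\<in>I. c j * G j x)) = (LINT x:A|M. F x) + (\<Sum>j\<in>I. c j * (LINT x:A|M. G j x))"
  using integral_add_weighted_sum[of M "\<lambda>x. indicator A x *\<^sub>R F x" I "\<lambda>j x. indicator A x *\<^sub>R G j x" c] assms
  by (simp add: set_integrable_def set_lebesgue_integral_def distrib_left sum_distrib_left mult.left_commute)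

lemma integral_sum_add_weighted_double_sum:
  fixes F :: "'i \<Rightarrow> 'a \<Rightarrow> real"
  assumes "\<And>i. i \<in> I \<Longrightarrow> integrable M (F i)" "\<And>i j. i \<in> I \<Longrightarrow> j \<in> R i \<Longrightarrow> integrable M (G i j)"
  shows "(LINT x|M. (\<Sum>i\<in>I. F i x) + (\<Sum>i\<in>I. \<Sum>j\<in>R i. c i j * G i j x)) =
    (\<Sum>i\<in>I. LINT x|M. F i x) + (\<Sum>i\<in>I. \<Sum>j\<in>R i. c i j * (LINT x|M. G i j x))"
  using assms by (simp add: Bochner_Integration.integral_add Bochner_Integration.integrable_sum Bochner_Integration.integral_sum)

lemma set_integral_sum_add_weighted_double_sum:
  fixes F :: "'i \<Rightarrow> 'a \<Rightarrow> real"
  assumes "\<And>i. i \<in> I \<Longrightarrow> set_integrable M A (F i)"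
    "\<And>i j. i \<in> I \<Longrightarrow> j \<in> R i \<Longrightarrow> set_integrable M A (G i j)"
  shows "(LINT x:A|M. (\<Sum>i\<in>I. F i x) + (\<Sum>i\<in>I. \<Sum>j\<in>R i. c i j * G i j x)) =
    (\<Sum>i\<in>I. LINT x:A|M. F i x) + (\<Sum>i\<in>I. \<Sum>j\<in>R i. c i j * (LINT x:A|M. G i j x))"
  using integral_sum_add_weighted_double_sum[of I M "\<lambda>i x. indicator A x *\<^sub>R F i x" R
    "\<lambda>i j x. indicator A x *\<^sub>R G i j x" c] assms
  by (simp add: set_integrable_def set_lebesgue_integral_def distrib_left sum_distrib_left mult.left_commute)

text \<open>Continuous paths make the process jointly measurable, so the time integral is a random
  variable; its absolute value is controlled by the iterated integral assumed finite.\<close>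

lemma (in prob_space) integrable_LINT_continuous_process:
  fixes h :: "real \<Rightarrow> 'a \<Rightarrow> real"
  assumes T: "0 \<le> T" and meas: "\<And>t. t \<in> {0..T} \<Longrightarrow> h t \<in> borel_measurable M"
    and cont: "\<And>\<omega>. \<omega> \<in> space M \<Longrightarrow> continuous_on {0..T} (\<lambda>t. h t \<omega>)"
    and fin: "(\<integral>\<^sup>+\<omega>. (\<integral>\<^sup>+t\<in>{0..T}. ennreal \<bar>h t \<omega>\<bar> \<partial>lborel) \<partial>M) < \<infinity>"
  shows "integrable M (\<lambda>\<omega>. LINT t:{0..T}|lborel. h t \<omega>)"
proof -
  define H where "H t \<omega> = h (max 0 (min T t)) \<omega>" for t \<omega>
  have "(\<lambda>(t, \<omega>). H t \<omega>) \<in> borel_measurable (borel \<Otimes>\<^sub>M M)"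
    unfolding H_def by (rule borel_measurable_continuous_process_Icc(1)[OF T meas cont])
  from measurable_compose[OF measurable_pair_swap' this]
  have [measurable]: "(\<lambda>(\<omega>, t). H t \<omega>) \<in> borel_measurable (M \<Otimes>\<^sub>M borel)"
    by (simp add: case_prod_unfold)
  have eq: "(LINT t:{0..T}|lborel. h t \<omega>) = (\<integral>t. indicator {0..T} t *\<^sub>R H t \<omega> \<partial>lborel)" for \<omega>
    unfolding set_lebesgue_integral_def
    by (intro Bochner_Integration.integral_cong) (auto simp: H_def indicator_def)
  have H_meas: "(\<lambda>\<omega>. LINT t:{0..T}|lborel. h t \<omega>) \<in> borel_measurable M"
    unfolding eq by measurable
  have "ennreal (norm (LINT t:{0..T}|lborel. h t \<omega>)) \<le> (\<integral>\<^sup>+t\<in>{0..T}. ennreal \<bar>h t \<omega>\<bar> \<partial>lborel)"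
    if "\<omega> \<in> space M" for \<omega>
  proof -
    have "set_integrable lborel {0..T} (\<lambda>t. h t \<omega>)"
      by (rule borel_integrable_atLeastAtMost'[OF cont[OF that]])
    then have "ennreal (norm (LINT t:{0..T}|lborel. h t \<omega>)) \<le>
      (\<integral>\<^sup>+t. norm (indicator {0..T} t *\<^sub>R h t \<omega>) \<partial>lborel)"
      unfolding set_lebesgue_integral_def set_integrable_def by (rule integral_norm_bound_ennreal)
    also have "\<dots> = (\<integral>\<^sup>+t\<in>{0..T}. ennreal \<bar>h t \<omega>\<bar> \<partial>lborel)"
      by (intro nn_integral_cong) (auto simp: indicator_def)
    finally show ?thesis .
  qed
  then have "(\<integral>\<^sup>+\<omega>. ennreal (norm (LINT t:{0..T}|lborel. h t \<omega>)) \<partial>M) < \<infinity>"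
    by (intro le_less_trans[OF nn_integral_mono fin])
  then show ?thesis using H_meas by (intro integrableI_bounded)
qed

text \<open>Comparison with the value at \<open>(0, a0)\<close> for one fixed action
  \<open>a0\<close>: the distance between actions is bounded by \<open>R\<close> and goes into the
  constant.\<close>

lemma lipschitz_on_imp_linear_growth:
  fixes F :: "'a::real_normed_vector \<Rightarrow> 'b::real_normed_vector \<Rightarrow> 'c::real_normed_vector"
  assumes lip: "L-lipschitz_on (UNIV \<times> A) (\<lambda>(x, a). F x a)" and A: "bounded A"
  shows "\<exists>C\<ge>0. \<forall>x. \<forall>a\<in>A. norm (F x a) \<le> C * (1 + norm x)"
proof (cases "A = {}")
  case False
  then obtain a0 where a0: "a0 \<in> A" by blast
  obtain R where R: "\<And>a. a \<in> A \<Longrightarrow> dist a0 a \<le> R" using A by (auto simp: bounded_any_center[of A a0])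
  have L: "0 \<le> L" using lip by (rule lipschitz_on_nonneg)
  have R0: "0 \<le> R" using R[OF a0] by simp
  define C where "C = norm (F 0 a0) + L * (1 + R)"
  have "norm (F x a) \<le> C * (1 + norm x)" if a: "a \<in> A" for x a
  proof -
    have "dist (F x a) (F 0 a0) \<le> L * dist (x, a) (0, a0)"
      using lipschitz_onD[OF lip, of "(x, a)" "(0, a0)"] a a0 by simp
    also have "\<dots> \<le> L * (norm x + R)"
      using L R[OF a] sqrt_sum_squares_le_sum[of "dist x 0" "dist a a0"]
      by (intro mult_left_mono) (auto simp: dist_Pair_Pair dist_commute)
    finally have "norm (F x a) \<le> norm (F 0 a0) + L * (norm x + R)"
      using norm_triangle_ineq2[of "F x a" "F 0 a0"] by (simp add: dist_norm)
    also have "\<dots> \<le> C * (1 + norm x)"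
      using L R0 mult_nonneg_nonneg[of "norm (F 0 a0)" "norm x"] mult_nonneg_nonneg[OF mult_nonneg_nonneg[OF L R0], of "norm x"]
      by (simp add: C_def algebra_simps)
    finally show ?thesis .
  qed
  moreover have "0 \<le> C" using L R0 by (simp add: C_def)
  ultimately show ?thesis by blast
qed auto

text \<open>Bounded action sets make the growth bounds uniform in the action, so the growth constant
  does not depend on the policy.\<close>

lemma (in brownian) controlled_sde_second_moment:
  fixes X :: "real \<Rightarrow> 'w \<Rightarrow> real^'d" and p :: "real \<times> (real^'d) \<Rightarrow> real^'k"
  assumes T: "0 \<le> T" and A: "bounded A" and p: "\<And>t x. t \<in> {0..T} \<Longrightarrow> p (t, x) \<in> A"
    and b: "\<exists>L. L-lipschitz_on (UNIV \<times> A) (\<lambda>(x, a). b x a)"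
    and \<sigma>: "\<exists>L. L-lipschitz_on (UNIV \<times> A) (\<lambda>(x, a). \<sigma> x a)"
    and sol: "sde_solution M W T (\<lambda>t x. b x (p (t, x))) (\<lambda>t x. \<sigma> x (p (t, x))) \<xi> X"
  shows "(\<integral>\<^sup>+\<omega>. (\<integral>\<^sup>+s\<in>{0..T}. ennreal (D * (1 + (norm (X s \<omega>))\<^sup>2)) \<partial>lborel) \<partial>M) < \<infinity>"
    and "t \<in> {0..T} \<Longrightarrow> (\<integral>\<^sup>+\<omega>. ennreal ((norm (X t \<omega>))\<^sup>2) \<partial>M) < \<infinity>"
proof -
  obtain C1 where C1: "\<And>x a. a \<in> A \<Longrightarrow> norm (b x a) \<le> C1 * (1 + norm x)"
    using b lipschitz_on_imp_linear_growth[OF _ A] by blast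
  obtain C2 where C2: "\<And>x a. a \<in> A \<Longrightarrow> norm (\<sigma> x a) \<le> C2 * (1 + norm x)"
    using \<sigma> lipschitz_on_imp_linear_growth[OF _ A] by blast
  have "norm (b x (p (t, x))) \<le> max C1 C2 * (1 + norm x)" if "t \<in> {0..T}" for t x
    by (rule order_trans[OF C1[OF p[OF that]] mult_right_mono]) auto
  moreover have "norm (\<sigma> x (p (t, x))) \<le> max C1 C2 * (1 + norm x)" if "t \<in> {0..T}" for t x
    by (rule order_trans[OF C2[OF p[OF that]] mult_right_mono]) auto
  ultimately show "(\<integral>\<^sup>+\<omega>. (\<integral>\<^sup>+s\<in>{0..T}. ennreal (D * (1 + (norm (X s \<omega>))\<^sup>2)) \<partial>lborel) \<partial>M) < \<infinity>"
    and "t \<in> {0..T} \<Longrightarrow> (\<integral>\<^sup>+\<omega>. ennreal ((norm (X t \<omega>))\<^sup>2) \<partial>M) < \<infinity>"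
    using sde_solution_second_moment[OF T sol] by blast+
qed

section \<open>From costs to the potential, and from the potential to equilibria\<close>

text \<open>At a minimizer every deviation changes the potential by a nonnegative amount, so it can
  lower the cost of the deviating player by at most \<open>\<alpha>\<close>.\<close>

lemma alpha_potential_minimizer_nash:
  assumes pot: "alpha_potential_function N P J \<alpha> \<Phi>"
    and min: "is_arg_min \<Phi> (\<lambda>\<psi>. \<psi> \<in> PiE {1..N} P) \<phi>"
  shows "nash_equilibrium N P J \<alpha> \<phi>"
proof -
  have \<phi>: "\<phi> \<in> PiE {1..N} P" using min by (simp add: is_arg_min_def)
  have "J i \<phi> \<le> J i (\<phi>(i := p)) + \<alpha>" if i: "i \<in> {1..N}" and p: "p \<in> P i" for i p
  proof -
    have "\<phi>(i := p) \<in> PiE {1..N} P" using \<phi> i p by (auto simp: PiE_def extensional_def)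
    then have le: "\<Phi> \<phi> \<le> \<Phi> (\<phi>(i := p))" using min by (auto simp: is_arg_min_def not_less)
    \<comment> \<open>The potential property ranges over extensional profiles of the other players,
      so entry \<open>i\<close> is erased first; the later updates overwrite it.\<close>
    have "\<phi>(i := undefined) \<in> PiE ({1..N} - {i}) P" "\<phi> i \<in> P i"
      using \<phi> i by (auto simp: PiE_def extensional_def)
    then have "\<bar>(J i ((\<phi>(i := undefined))(i := p)) - J i ((\<phi>(i := undefined))(i := \<phi> i))) -
        (\<Phi> ((\<phi>(i := undefined))(i := p)) - \<Phi> ((\<phi>(i := undefined))(i := \<phi> i)))\<bar> \<le> \<alpha>"
      using pot i p unfolding alpha_potential_function_def by blast
    then show ?thesis using le by simp
  qed
  then show ?thesis using \<phi> by (simp add: nash_equilibrium_def)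
qed

text \<open>Each unordered pair occurs once, with the smaller index first; those in which
  \<open>i\<close> is the larger index are turned around by symmetry. This isolates the pairs of the
  potential that a deviation of player \<open>i\<close> affects.\<close>

lemma sum_pairs_containing:
  fixes d :: "nat \<Rightarrow> nat \<Rightarrow> real"
  assumes i: "i \<in> {1..N}" and zero: "\<And>a b. a \<noteq> i \<Longrightarrow> b \<noteq> i \<Longrightarrow> d a b = 0" and sym: "\<And>a b. d a b = d b a"
  shows "(\<Sum>a\<in>{1..N}. \<Sum>b\<in>{a<..N}. d a b) = (\<Sum>j\<in>{1..N} - {i}. d i j)"
proof -
  have inner: "(\<Sum>b\<in>{a<..N}. d a b) = (if a < i then d i a else 0)" if "a \<noteq> i" for a
  proof -
    have "(\<Sum>b\<in>{a<..N}. d a b) = (\<Sum>b\<in>{a<..N}. if b = i then d i a else 0)"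
      using zero that sym[of a i] by (intro sum.cong) auto
    then show ?thesis using i by simp
  qed
  have "(\<Sum>a\<in>{1..N}. \<Sum>b\<in>{a<..N}. d a b) = (\<Sum>b\<in>{i<..N}. d i b) + (\<Sum>a\<in>{1..N} - {i}. \<Sum>b\<in>{a<..N}. d a b)"
    using i by (subst sum.remove[of _ i]) auto
  also have "(\<Sum>a\<in>{1..N} - {i}. \<Sum>b\<in>{a<..N}. d a b) = (\<Sum>a\<in>{1..N} - {i}. if a < i then d i a else 0)"
    by (intro sum.cong) (auto simp: inner)
  also have "\<dots> = (\<Sum>a\<in>{1..<i}. d i a)"
    using i by (intro sum.mono_neutral_cong_right) auto
  finally have "(\<Sum>a\<in>{1..N}. \<Sum>b\<in>{a<..N}. d a b) = sum (d i) ({1..<i} \<union> {i<..N})"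
    by (subst sum.union_disjoint) auto
  also have "{1..<i} \<union> {i<..N} = {1..N} - {i}" using i by auto
  finally show ?thesis .
qed

text \<open>Separates the algebra of the game from stochastic analysis: the dynamics enter only
  through integrability, first in time along each path and then over the probability space.\<close>

lemma (in prob_space) alpha_potential_function_symmetric_interaction:
  fixes X :: "nat \<Rightarrow> (real \<times> (real^'d) \<Rightarrow> real^'k) \<Rightarrow> real \<Rightarrow> 'a \<Rightarrow> real^'d"
  assumes T: "0 \<le> T" and N: "1 \<le> N"
    and f_path: "\<And>i p \<omega>. i \<in> {1..N} \<Longrightarrow> p \<in> P i \<Longrightarrow> \<omega> \<in> space M \<Longrightarrow>
      set_integrable lborel {0..T} (\<lambda>t. f i (X i p t \<omega>) (p (t, X i p t \<omega>)))"
    and f_int: "\<And>i p. i \<in> {1..N} \<Longrightarrow> p \<in> P i \<Longrightarrow>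
      integrable M (\<lambda>\<omega>. LINT t:{0..T}|lborel. f i (X i p t \<omega>) (p (t, X i p t \<omega>)))"
    and g_int: "\<And>i p. i \<in> {1..N} \<Longrightarrow> p \<in> P i \<Longrightarrow> integrable M (\<lambda>\<omega>. g i (X i p T \<omega>))"
    and K_path: "\<And>i j p q \<omega>. i \<in> {1..N} \<Longrightarrow> p \<in> P i \<Longrightarrow> j \<in> {1..N} \<Longrightarrow> q \<in> P j \<Longrightarrow> \<omega> \<in> space M \<Longrightarrow>
      set_integrable lborel {0..T} (\<lambda>t. K (X i p t \<omega> - X j q t \<omega>))"
    and K_int: "\<And>i j p q. i \<in> {1..N} \<Longrightarrow> p \<in> P i \<Longrightarrow> j \<in> {1..N} \<Longrightarrow> q \<in> P j \<Longrightarrow>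
      integrable M (\<lambda>\<omega>. LINT t:{0..T}|lborel. K (X i p t \<omega> - X j q t \<omega>))"
    and K_le: "\<And>x. \<bar>K x\<bar> \<le> B" and K_even: "\<And>x. K x = K (- x)"
  shows "alpha_potential_function N P (player_cost M T N f g lam K X)
    (T * B * (MAX i\<in>{1..N}. \<Sum>j\<in>{1..N} - {i}. \<bar>lam i j - lam j i\<bar>)) (potential M T N f g lam K X)"
proof -
  \<comment> \<open>\<open>Z\<close> depends on the policy of one player, \<open>k\<close> on those
    of a pair. Costs and potential are linear in these numbers, and \<open>Z i\<close> has
    coefficient 1 in both, so it cancels from the difference.\<close>
  define Z where "Z i p = (LINT \<omega>|M. (LINT t:{0..T}|lborel. f i (X i p t \<omega>) (p (t, X i p t \<omega>))) + g i (X i p T \<omega>))" for i p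
  define k where "k i j \<phi> = (LINT \<omega>|M. (LINT t:{0..T}|lborel. K (X i (\<phi> i) t \<omega> - X j (\<phi> j) t \<omega>)))" for i j \<phi>
  have J_eq: "player_cost M T N f g lam K X i \<phi> = Z i (\<phi> i) + (\<Sum>j\<in>{1..N} - {i}. lam i j * k i j \<phi>)"
    if \<phi>: "\<And>j. j \<in> {1..N} \<Longrightarrow> \<phi> j \<in> P j" and i: "i \<in> {1..N}" for i \<phi>
  proof -
    have "player_cost M T N f g lam K X i \<phi> =
      (LINT \<omega>|M. ((LINT t:{0..T}|lborel. f i (X i (\<phi> i) t \<omega>) (\<phi> i (t, X i (\<phi> i) t \<omega>))) + g i (X i (\<phi> i) T \<omega>)) +
        (\<Sum>j\<in>{1..N} - {i}. lam i j * (LINT t:{0..T}|lborel. K (X i (\<phi> i) t \<omega> - X j (\<phi> j) t \<omega>))))"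
      unfolding player_cost_def
    proof (intro Bochner_Integration.integral_cong refl)
      fix \<omega> assume \<omega>: "\<omega> \<in> space M"
      show "(LINT t:{0..T}|lborel. f i (X i (\<phi> i) t \<omega>) (\<phi> i (t, X i (\<phi> i) t \<omega>)) +
           (\<Sum>j\<in>{1..N} - {i}. lam i j * K (X i (\<phi> i) t \<omega> - X j (\<phi> j) t \<omega>))) + g i (X i (\<phi> i) T \<omega>) =
        ((LINT t:{0..T}|lborel. f i (X i (\<phi> i) t \<omega>) (\<phi> i (t, X i (\<phi> i) t \<omega>))) + g i (X i (\<phi> i) T \<omega>)) +
        (\<Sum>j\<in>{1..N} - {i}. lam i j * (LINT t:{0..T}|lborel. K (X i (\<phi> i) t \<omega> - X j (\<phi> j) t \<omega>)))"
        using i \<phi> \<omega> by (subst set_integral_add_weighted_sum) (auto intro: f_path K_path)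
    qed
    also have "\<dots> = Z i (\<phi> i) + (\<Sum>j\<in>{1..N} - {i}. lam i j * k i j \<phi>)"
      unfolding Z_def k_def using i \<phi>
      by (intro integral_add_weighted_sum Bochner_Integration.integrable_add f_int g_int K_int) auto
    finally show ?thesis .
  qed
  have \<Phi>_eq: "potential M T N f g lam K X \<phi> = (\<Sum>i\<in>{1..N}. Z i (\<phi> i)) +
      (\<Sum>i\<in>{1..N}. \<Sum>j\<in>{i<..N}. (lam i j + lam j i) / 2 * k i j \<phi>)"
    if \<phi>: "\<And>j. j \<in> {1..N} \<Longrightarrow> \<phi> j \<in> P j" for \<phi>
  proof -
    have "potential M T N f g lam K X \<phi> =
      (LINT \<omega>|M. (\<Sum>i\<in>{1..N}. (LINT t:{0..T}|lborel. f i (X i (\<phi> i) t \<omega>) (\<phi> i (t, X i (\<phi> i) t \<omega>))) + g i (X i (\<phi> i) T \<omega>)) +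
        (\<Sum>i\<in>{1..N}. \<Sum>j\<in>{i<..N}. (lam i j + lam j i) / 2 *
          (LINT t:{0..T}|lborel. K (X i (\<phi> i) t \<omega> - X j (\<phi> j) t \<omega>))))"
      unfolding potential_def potential_running_def potential_terminal_def
    proof (intro Bochner_Integration.integral_cong refl)
      fix \<omega> assume \<omega>: "\<omega> \<in> space M"
      show "(LINT t:{0..T}|lborel. (\<Sum>i\<in>{1..N}. f i (X i (\<phi> i) t \<omega>) (\<phi> i (t, X i (\<phi> i) t \<omega>))) +
           (\<Sum>i\<in>{1..N}. \<Sum>j\<in>{i<..N}. (lam i j + lam j i) / 2 * K (X i (\<phi> i) t \<omega> - X j (\<phi> j) t \<omega>))) +
           (\<Sum>i\<in>{1..N}. g i (X i (\<phi> i) T \<omega>)) =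
        (\<Sum>i\<in>{1..N}. (LINT t:{0..T}|lborel. f i (X i (\<phi> i) t \<omega>) (\<phi> i (t, X i (\<phi> i) t \<omega>))) + g i (X i (\<phi> i) T \<omega>)) +
        (\<Sum>i\<in>{1..N}. \<Sum>j\<in>{i<..N}. (lam i j + lam j i) / 2 *
          (LINT t:{0..T}|lborel. K (X i (\<phi> i) t \<omega> - X j (\<phi> j) t \<omega>)))"
        using \<phi> \<omega>
        by (subst set_integral_sum_add_weighted_double_sum) (auto intro: f_path K_path simp: sum.distrib)
    qed
    also have "\<dots> = (\<Sum>i\<in>{1..N}. Z i (\<phi> i)) +
      (\<Sum>i\<in>{1..N}. \<Sum>j\<in>{i<..N}. (lam i j + lam j i) / 2 * k i j \<phi>)"
      unfolding Z_def k_def using \<phi>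
      by (intro integral_sum_add_weighted_double_sum Bochner_Integration.integrable_add f_int g_int K_int) auto
    finally show ?thesis .
  qed
  have k_sym: "k i j \<phi> = k j i \<phi>" for i j \<phi>
    unfolding k_def by (subst K_even) simp
  have B: "0 \<le> B" using K_le[of 0] by simp
  have k_le: "\<bar>k i j \<phi>\<bar> \<le> T * B"
    if "i \<in> {1..N}" "j \<in> {1..N}" "\<phi> i \<in> P i" "\<phi> j \<in> P j" for i j \<phi>
  proof -
    have "\<bar>LINT t:{0..T}|lborel. K (X i (\<phi> i) t \<omega> - X j (\<phi> j) t \<omega>)\<bar> \<le> T * B" if "\<omega> \<in> space M" for \<omega>
    proof -
      have "norm (LINT t:{0..T}|lborel. K (X i (\<phi> i) t \<omega> - X j (\<phi> j) t \<omega>)) \<le>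
        (LINT t:{0..T}|lborel. norm (K (X i (\<phi> i) t \<omega> - X j (\<phi> j) t \<omega>)))"
        using K_path \<open>i \<in> _\<close> \<open>j \<in> _\<close> \<open>\<phi> i \<in> _\<close> \<open>\<phi> j \<in> _\<close> that by (intro set_integral_norm_bound) auto
      also have "\<dots> \<le> (LINT t:{0..T}|lborel. B)"
      proof (intro set_integral_mono set_integrable_norm)
        show "set_integrable lborel {0..T} (\<lambda>_. B)"
          by (intro borel_integrable_atLeastAtMost' continuous_on_const)
      qed (use K_path \<open>i \<in> _\<close> \<open>j \<in> _\<close> \<open>\<phi> i \<in> _\<close> \<open>\<phi> j \<in> _\<close> that K_le in auto)
      also have "\<dots> = T * B" using T by (simp add: set_lebesgue_integral_def)
      finally show ?thesis by simp
    qed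
    moreover have "integrable M (\<lambda>\<omega>. LINT t:{0..T}|lborel. K (X i (\<phi> i) t \<omega> - X j (\<phi> j) t \<omega>))"
      using that by (intro K_int)
    ultimately have "\<bar>k i j \<phi>\<bar> \<le> (LINT \<omega>|M. T * B)"
      unfolding k_def by (intro integral_abs_bound[THEN order_trans] integral_mono) auto
    then show ?thesis by (simp add: prob_space)
  qed
  show ?thesis
    unfolding alpha_potential_function_def
  proof (intro ballI)
    fix i \<phi> p p'
    assume i: "i \<in> {1..N}" and \<phi>: "\<phi> \<in> PiE ({1..N} - {i}) P" and p: "p \<in> P i" and p': "p' \<in> P i"
    define \<psi> where "\<psi> q = \<phi>(i := q)" for q
    have adm: "\<psi> q j \<in> P j" if "q \<in> P i" "j \<in> {1..N}" for q j
      unfolding \<psi>_def using PiE_mem[OF \<phi>, of j] that by (cases "j = i") simp_all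
    define \<Delta> where "\<Delta> a b = k a b (\<psi> p') - k a b (\<psi> p)" for a b
    have \<Delta>_sym: "\<Delta> a b = \<Delta> b a" for a b unfolding \<Delta>_def by (simp only: k_sym[of a b])
    have "(\<Sum>a\<in>{1..N}. \<Sum>b\<in>{a<..N}. (lam a b + lam b a) / 2 * \<Delta> a b) =
       (\<Sum>j\<in>{1..N} - {i}. (lam i j + lam j i) / 2 * \<Delta> i j)"
    proof (rule sum_pairs_containing[OF i])
      show "(lam a b + lam b a) / 2 * \<Delta> a b = (lam b a + lam a b) / 2 * \<Delta> b a" for a b
        by (simp only: \<Delta>_sym[of a b] add.commute)
    \<comment> \<open>For a pair that avoids \<open>i\<close>, both policies are the same before and
      after the deviation.\<close>
    qed (simp add: \<Delta>_def k_def \<psi>_def)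
    moreover have "(\<Sum>a\<in>{1..N}. Z a (\<psi> q a)) = Z i q + (\<Sum>a\<in>{1..N} - {i}. Z a (\<phi> a))" for q
      by (subst sum.remove[OF _ i]) (auto simp: \<psi>_def intro!: sum.cong)
    ultimately have "potential M T N f g lam K X (\<psi> p') - potential M T N f g lam K X (\<psi> p) =
      Z i p' - Z i p + (\<Sum>j\<in>{1..N} - {i}. (lam i j + lam j i) / 2 * \<Delta> i j)"
      using \<Phi>_eq[OF adm[OF p]] \<Phi>_eq[OF adm[OF p']]
      by (simp add: \<Delta>_def right_diff_distrib sum_subtractf)
    moreover have "player_cost M T N f g lam K X i (\<psi> p') - player_cost M T N f g lam K X i (\<psi> p) =
      Z i (\<psi> p' i) - Z i (\<psi> p i) + (\<Sum>j\<in>{1..N} - {i}. lam i j * \<Delta> i j)"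
      using J_eq[OF adm[OF p] i] J_eq[OF adm[OF p'] i]
      by (simp add: \<Delta>_def right_diff_distrib sum_subtractf)
    moreover have "\<psi> p i = p" "\<psi> p' i = p'" by (simp_all add: \<psi>_def)
    moreover have "(\<Sum>j\<in>{1..N} - {i}. lam i j * \<Delta> i j) - (\<Sum>j\<in>{1..N} - {i}. (lam i j + lam j i) / 2 * \<Delta> i j) =
       (\<Sum>j\<in>{1..N} - {i}. (lam i j - lam j i) / 2 * \<Delta> i j)"
      unfolding sum_subtractf[symmetric] by (intro sum.cong refl) (simp add: field_simps)
    ultimately have gap: "(player_cost M T N f g lam K X i (\<psi> p') - player_cost M T N f g lam K X i (\<psi> p)) -
       (potential M T N f g lam K X (\<psi> p') - potential M T N f g lam K X (\<psi> p)) =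
       (\<Sum>j\<in>{1..N} - {i}. (lam i j - lam j i) / 2 * \<Delta> i j)"
      by simp
    have \<Delta>_le: "\<bar>\<Delta> i j\<bar> \<le> 2 * (T * B)" if "j \<in> {1..N}" for j
      using k_le[of i j "\<psi> p'"] k_le[of i j "\<psi> p"] adm[OF p i] adm[OF p' i] adm[OF p that] adm[OF p' that] i that
      unfolding \<Delta>_def by linarith
    have "\<bar>\<Sum>j\<in>{1..N} - {i}. (lam i j - lam j i) / 2 * \<Delta> i j\<bar> \<le> (\<Sum>j\<in>{1..N} - {i}. \<bar>lam i j - lam j i\<bar> / 2 * (2 * (T * B)))"
    proof (intro order_trans[OF sum_abs] sum_mono)
      fix j assume "j \<in> {1..N} - {i}"
      then have "\<bar>\<Delta> i j\<bar> \<le> 2 * (T * B)" using \<Delta>_le by blast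
      then have "\<bar>lam i j - lam j i\<bar> / 2 * \<bar>\<Delta> i j\<bar> \<le> \<bar>lam i j - lam j i\<bar> / 2 * (2 * (T * B))"
        by (rule mult_left_mono) simp
      then show "\<bar>(lam i j - lam j i) / 2 * \<Delta> i j\<bar> \<le> \<bar>lam i j - lam j i\<bar> / 2 * (2 * (T * B))"
        by (simp add: abs_mult)
    qed
    also have "\<dots> = T * B * (\<Sum>j\<in>{1..N} - {i}. \<bar>lam i j - lam j i\<bar>)"
      by (simp add: sum_distrib_left mult_ac)
    also have "\<dots> \<le> T * B * (MAX i\<in>{1..N}. \<Sum>j\<in>{1..N} - {i}. \<bar>lam i j - lam j i\<bar>)"
      using T B i by (intro mult_left_mono Max_ge) auto
    finally show "\<bar>(player_cost M T N f g lam K X i (\<phi>(i := p')) - player_cost M T N f g lam K X i (\<phi>(i := p))) -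
       (potential M T N f g lam K X (\<phi>(i := p')) - potential M T N f g lam K X (\<phi>(i := p)))\<bar> \<le>
       T * B * (MAX i\<in>{1..N}. \<Sum>j\<in>{1..N} - {i}. \<bar>lam i j - lam j i\<bar>)"
      unfolding \<psi>_def[symmetric] gap .
  qed
qed

theorem proposition4p2:
  fixes M :: "'w measure"
    and W :: "real \<Rightarrow> 'w \<Rightarrow> real^'m"
    and T :: real
    and N :: nat
    and A :: "nat \<Rightarrow> (real^'k) set"
    and P :: "nat \<Rightarrow> (real \<times> (real^'d) \<Rightarrow> real^'k) set"
    and b :: "nat \<Rightarrow> real^'d \<Rightarrow> real^'k \<Rightarrow> real^'d"
    and \<sigma> :: "nat \<Rightarrow> real^'d \<Rightarrow> real^'k \<Rightarrow> real^'m^'d"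
    and \<xi> :: "nat \<Rightarrow> real^'d"
    and f :: "nat \<Rightarrow> real^'d \<Rightarrow> real^'k \<Rightarrow> real"
    and g :: "nat \<Rightarrow> real^'d \<Rightarrow> real"
    and lam :: "nat \<Rightarrow> nat \<Rightarrow> real"
    and K :: "real^'d \<Rightarrow> real"
    and X :: "nat \<Rightarrow> (real \<times> (real^'d) \<Rightarrow> real^'k) \<Rightarrow> real \<Rightarrow> 'w \<Rightarrow> real^'d"
  assumes "0 < T" and "1 \<le> N"
    and "prob_space M" and "complete_measure M"
    and "brownian_motion M W"
    and "\<And>i. i \<in> {1..N} \<Longrightarrow> A i \<noteq> {} \<and> compact (A i)"
    and "\<And>i. i \<in> {1..N} \<Longrightarrow> admissible_policies T (A i) (P i)"
    and "\<And>i. i \<in> {1..N} \<Longrightarrow> \<exists>L. L-lipschitz_on (UNIV \<times> A i) (\<lambda>(x, a). b i x a)"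
    and "\<And>i. i \<in> {1..N} \<Longrightarrow> \<exists>L. L-lipschitz_on (UNIV \<times> A i) (\<lambda>(x, a). \<sigma> i x a)"
    and "\<And>i p. i \<in> {1..N} \<Longrightarrow> p \<in> P i \<Longrightarrow>
           sde_solution M W T (\<lambda>t x. b i x (p (t, x))) (\<lambda>t x. \<sigma> i x (p (t, x))) (\<xi> i) (X i p)"
    and "\<And>i. i \<in> {1..N} \<Longrightarrow> continuous_on (UNIV \<times> A i) (\<lambda>(x, a). f i x a)"
    and "\<And>i. i \<in> {1..N} \<Longrightarrow>
           \<exists>C. \<forall>x. \<forall>a\<in>A i. \<bar>f i x a\<bar> \<le> C * (1 + (norm x)\<^sup>2 + (norm a)\<^sup>2)"
    and "\<And>i. i \<in> {1..N} \<Longrightarrow> continuous_on UNIV (g i)"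
    and "\<And>i. i \<in> {1..N} \<Longrightarrow> \<exists>C. \<forall>x. \<bar>g i x\<bar> \<le> C * (1 + (norm x)\<^sup>2)"
    and "\<And>i j. i \<in> {1..N} \<Longrightarrow> j \<in> {1..N} \<Longrightarrow> j \<noteq> i \<Longrightarrow> 0 \<le> lam i j"
    and "continuous_on UNIV K" and "bounded (range K)"
    and "\<And>x. K x = K (- x)" and "\<exists>x. K x \<noteq> 0"
  shows "\<exists>\<alpha>\<ge>0.
    \<alpha> \<le> T * (SUP x. \<bar>K x\<bar>) * (MAX i\<in>{1..N}. \<Sum>j\<in>{1..N} - {i}. \<bar>lam i j - lam j i\<bar>) \<and>
    alpha_potential_function N P (player_cost M T N f g lam K X) \<alpha>
      (potential M T N f g lam K X) \<and>
    (\<forall>\<phi>. is_arg_min (potential M T N f g lam K X) (\<lambda>\<psi>. \<psi> \<in> PiE {1..N} P) \<phi> \<longrightarrow>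
       nash_equilibrium N P (player_cost M T N f g lam K X) \<alpha> \<phi>)"
proof -
  interpret brownian M W
    using assms(3,5) by (simp add: brownian_def brownian_axioms_def)
  define B where "B = (SUP x. \<bar>K x\<bar>)"
  \<comment> \<open>The claimed upper bound itself serves as \<open>\<alpha>\<close>, so the
    comparison in the conclusion holds by reflexivity.\<close>
  let ?\<alpha> = "T * B * (MAX i\<in>{1..N}. \<Sum>j\<in>{1..N} - {i}. \<bar>lam i j - lam j i\<bar>)"
  have T: "0 \<le> T" using assms(1) by simp
  have K_le: "\<bar>K x\<bar> \<le> B" for x
  proof -
    \<comment> \<open>A real supremum bounds its family only if the family is bounded above; this is
      where boundedness of \<open>K\<close> enters.\<close>
    have "bdd_above (range (\<lambda>x. \<bar>K x\<bar>))"
      using assms(17) by (auto simp: bounded_iff bdd_above_def)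
    then show ?thesis unfolding B_def by (intro cSUP_upper) auto
  qed
  have B: "0 \<le> B" using K_le[of 0] by simp
  have p_cont: "continuous_on ({0..T} \<times> UNIV) p" and p_in: "\<And>t x. t \<in> {0..T} \<Longrightarrow> p (t, x) \<in> A i"
    if "i \<in> {1..N}" "p \<in> P i" for i p
  proof -
    have "continuous_map (top_of_set ({0..T} \<times> UNIV)) (top_of_set (A i)) p"
      using assms(7)[OF that(1)] that(2) by (auto simp: admissible_policies_def cont_maps_def)
    then show "continuous_on ({0..T} \<times> UNIV) p" "\<And>t x. t \<in> {0..T} \<Longrightarrow> p (t, x) \<in> A i"
      by (auto simp: continuous_map_in_subtopology)
  qed
  have X_meas: "X i p t \<in> borel_measurable M" if "i \<in> {1..N}" "p \<in> P i" "t \<in> {0..T}" for i p t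
    using assms(10)[OF that(1,2)] that(3)
    by (intro measurable_filtration_imp[of _ t]) (auto simp: sde_solution_def)
  have X_cont: "continuous_on {0..T} (\<lambda>t. X i p t \<omega>)" if "i \<in> {1..N}" "p \<in> P i" "\<omega> \<in> space M" for i p \<omega>
    using assms(10)[OF that(1,2)] that(3) by (auto simp: sde_solution_def)
  have A: "bounded (A i)" if "i \<in> {1..N}" for i
    using assms(6)[OF that] compact_imp_bounded by blast
  have moments: "(\<integral>\<^sup>+\<omega>. (\<integral>\<^sup>+t\<in>{0..T}. ennreal (D * (1 + (norm (X i p t \<omega>))\<^sup>2)) \<partial>lborel) \<partial>M) < \<infinity>"
      "(\<integral>\<^sup>+\<omega>. ennreal ((norm (X i p T \<omega>))\<^sup>2) \<partial>M) < \<infinity>"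
    if i: "i \<in> {1..N}" and p: "p \<in> P i" for i p D
    using controlled_sde_second_moment[OF T A[OF i] p_in[OF i p] assms(8)[OF i] assms(9)[OF i] assms(10)[OF i p]] T
    by auto
  have f_cont: "continuous_on {0..T} (\<lambda>t. f i (X i p t \<omega>) (p (t, X i p t \<omega>)))"
    if i: "i \<in> {1..N}" and p: "p \<in> P i" and \<omega>: "\<omega> \<in> space M" for i p \<omega>
  proof -
    have "continuous_on {0..T} (\<lambda>t. p (t, X i p t \<omega>))"
      by (rule continuous_on_compose2[OF p_cont[OF i p]])
         (auto intro!: continuous_intros X_cont[OF i p \<omega>])
    from continuous_on_compose2[OF assms(11)[OF i] continuous_on_Pair[OF X_cont[OF i p \<omega>] this]]
    show ?thesis using p_in[OF i p] by (simp add: image_subset_iff)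
  qed
  have f_meas: "(\<lambda>\<omega>. f i (X i p t \<omega>) (p (t, X i p t \<omega>))) \<in> borel_measurable M"
    if i: "i \<in> {1..N}" and p: "p \<in> P i" and t: "t \<in> {0..T}" for i p t
  proof -
    have "continuous_on UNIV (\<lambda>x. p (t, x))"
      by (rule continuous_on_compose2[OF p_cont[OF i p]]) (use t in \<open>auto intro!: continuous_intros\<close>)
    from continuous_on_compose2[OF assms(11)[OF i] continuous_on_Pair[OF continuous_on_id this]]
    have "continuous_on UNIV (\<lambda>x. f i x (p (t, x)))" using p_in[OF i p t] by auto
    from measurable_compose[OF X_meas[OF i p t] borel_measurable_continuous_onI[OF this]] show ?thesis .
  qed
  have f_int: "integrable M (\<lambda>\<omega>. LINT t:{0..T}|lborel. f i (X i p t \<omega>) (p (t, X i p t \<omega>)))"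
    if i: "i \<in> {1..N}" and p: "p \<in> P i" for i p
  proof (rule integrable_LINT_continuous_process[OF T f_meas[OF i p] f_cont[OF i p]])
    obtain C where C: "\<And>x a. a \<in> A i \<Longrightarrow> \<bar>f i x a\<bar> \<le> C * (1 + (norm x)\<^sup>2 + (norm a)\<^sup>2)"
      using assms(12)[OF i] by blast
    obtain R where R: "\<And>a. a \<in> A i \<Longrightarrow> norm a \<le> R"
      using A[OF i] by (auto simp: bounded_iff)
    \<comment> \<open>Actions stay in a bounded set, so their quadratic term is absorbed into the
      constant, leaving the form covered by \<open>moments\<close> with this constant as
      \<open>D\<close>.\<close>
    have f_le: "\<bar>f i x a\<bar> \<le> \<bar>C\<bar> * (1 + R\<^sup>2) * (1 + (norm x)\<^sup>2)" if a: "a \<in> A i" for x a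
    proof -
      have "(norm a)\<^sup>2 \<le> R\<^sup>2" using R[OF a] by (intro power_mono) auto
      then have "1 + (norm x)\<^sup>2 + (norm a)\<^sup>2 \<le> (1 + R\<^sup>2) * (1 + (norm x)\<^sup>2)"
        by (simp add: algebra_simps add_increasing2)
      then have "C * (1 + (norm x)\<^sup>2 + (norm a)\<^sup>2) \<le> \<bar>C\<bar> * ((1 + R\<^sup>2) * (1 + (norm x)\<^sup>2))"
        by (intro mult_mono) auto
      then show ?thesis using C[OF a, of x] by (simp add: mult.assoc)
    qed
    have "(\<integral>\<^sup>+\<omega>. (\<integral>\<^sup>+t\<in>{0..T}. ennreal \<bar>f i (X i p t \<omega>) (p (t, X i p t \<omega>))\<bar> \<partial>lborel) \<partial>M) \<le>
      (\<integral>\<^sup>+\<omega>. (\<integral>\<^sup>+t\<in>{0..T}. ennreal (\<bar>C\<bar> * (1 + R\<^sup>2) * (1 + (norm (X i p t \<omega>))\<^sup>2)) \<partial>lborel) \<partial>M)"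
      by (intro nn_integral_mono) (auto simp: indicator_def intro!: ennreal_leI f_le p_in[OF i p])
    also have "\<dots> < \<infinity>" by (rule moments(1)[OF i p])
    finally show "(\<integral>\<^sup>+\<omega>. (\<integral>\<^sup>+t\<in>{0..T}. ennreal \<bar>f i (X i p t \<omega>) (p (t, X i p t \<omega>))\<bar> \<partial>lborel) \<partial>M) < \<infinity>" .
  qed
  have g_int: "integrable M (\<lambda>\<omega>. g i (X i p T \<omega>))" if i: "i \<in> {1..N}" and p: "p \<in> P i" for i p
  proof -
    obtain C where C: "\<And>x. \<bar>g i x\<bar> \<le> C * (1 + (norm x)\<^sup>2)"
      using assms(14)[OF i] by blast
    have [measurable]: "X i p T \<in> borel_measurable M" using X_meas[OF i p] T by simp
    have "integrable M (\<lambda>\<omega>. (norm (X i p T \<omega>))\<^sup>2)"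
      using moments(2)[OF i p] by (intro integrableI_bounded) auto
    then have "integrable M (\<lambda>\<omega>. C * (1 + (norm (X i p T \<omega>))\<^sup>2))" by simp
    moreover have "(\<lambda>\<omega>. g i (X i p T \<omega>)) \<in> borel_measurable M"
      by (rule measurable_compose[OF _ borel_measurable_continuous_onI[OF assms(13)[OF i]]]) simp
    ultimately show ?thesis
      by (rule Bochner_Integration.integrable_bound) (auto intro!: AE_I2 order_trans[OF C])
  qed
  have K_cont: "continuous_on {0..T} (\<lambda>t. K (X i p t \<omega> - X j q t \<omega>))"
    if "i \<in> {1..N}" "p \<in> P i" "j \<in> {1..N}" "q \<in> P j" "\<omega> \<in> space M" for i p j q \<omega>
    by (rule continuous_on_compose2[OF assms(16)]) (auto intro!: continuous_on_diff X_cont that)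
  have K_int: "integrable M (\<lambda>\<omega>. LINT t:{0..T}|lborel. K (X i p t \<omega> - X j q t \<omega>))"
    if ij: "i \<in> {1..N}" "p \<in> P i" "j \<in> {1..N}" "q \<in> P j" for i p j q
  proof (rule integrable_LINT_continuous_process[OF T _ K_cont[OF ij]])
    show "(\<lambda>\<omega>. K (X i p t \<omega> - X j q t \<omega>)) \<in> borel_measurable M" if t: "t \<in> {0..T}" for t
      using X_meas[OF ij(1,2) t] X_meas[OF ij(3,4) t]
      by (intro measurable_compose[OF _ borel_measurable_continuous_onI[OF assms(16)]] borel_measurable_diff)
    have "(\<integral>\<^sup>+\<omega>. (\<integral>\<^sup>+t\<in>{0..T}. ennreal \<bar>K (X i p t \<omega> - X j q t \<omega>)\<bar> \<partial>lborel) \<partial>M) \<le>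
      (\<integral>\<^sup>+\<omega>. (\<integral>\<^sup>+t\<in>{0..T}. ennreal B \<partial>lborel) \<partial>M)"
      by (intro nn_integral_mono mult_right_mono ennreal_leI K_le) auto
    also have "\<dots> < \<infinity>"
      using T by (simp add: nn_integral_cmult_indicator emeasure_space_1 ennreal_mult_less_top)
    finally show "(\<integral>\<^sup>+\<omega>. (\<integral>\<^sup>+t\<in>{0..T}. ennreal \<bar>K (X i p t \<omega> - X j q t \<omega>)\<bar> \<partial>lborel) \<partial>M) < \<infinity>" .
  qed
  have pot: "alpha_potential_function N P (player_cost M T N f g lam K X) ?\<alpha> (potential M T N f g lam K X)"
    by (rule alpha_potential_function_symmetric_interaction[where B=B,
          OF T assms(2) borel_integrable_atLeastAtMost'[OF f_cont] f_int g_int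
             borel_integrable_atLeastAtMost'[OF K_cont] K_int K_le assms(18)])
  have "0 \<le> (MAX i\<in>{1..N}. \<Sum>j\<in>{1..N} - {i}. \<bar>lam i j - lam j i\<bar>)"
  proof -
    \<comment> \<open>Player 1 exists because \<open>N\<close> is at least 1; the maximum is taken
      over a nonempty set and dominates a nonnegative sum.\<close>
    have "0 \<le> (\<Sum>j\<in>{1..N} - {1}. \<bar>lam 1 j - lam j 1\<bar>)" by (rule sum_nonneg) simp
    also have "\<dots> \<le> (MAX i\<in>{1..N}. \<Sum>j\<in>{1..N} - {i}. \<bar>lam i j - lam j i\<bar>)"
      using assms(2) by (intro Max_ge) auto
    finally show ?thesis .
  qed
  then have "0 \<le> ?\<alpha>" using T B by simp
  then show ?thesis
    using pot alpha_potential_minimizer_nash[OF pot] unfolding B_def by blast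
qed

end
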